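(* Let $k,l,m,n$ be integers such that $n=k(m-l)+l$, where $k\geq 1$, $m\geq 2$ and $\lceil \frac{m}{2}\rceil\leq l<m$. Let $K$ be a field, $R=K[x_1,\dots,x_n]$, and let $I_{m,l,k}=(u_1,\dots,u_k)\subseteq R$ with $u_i=\prod_{j=1}^{m}x_{(i-1)(m-l)+j}$ for $1\leq i\leq k$. Suppose $m\equiv 0 \pmod{m-l}$ and write $n=p(2m-l)+d$ with integers $p,d$ such that $0\leq d<2m-l$. Then: (1) $\mathrm{pd}(I_{m,l,k})=2p-1$ if $d\neq m$, and $\mathrm{pd}(I_{m,l,k})=2p$ if $d=m$; (2) $\mathrm{reg}(I_{m,l,k})=p(2m-l-2)+1$ if $d\neq m$, and $\mathrm{reg}(I_{m,l,k})=p(2m-l-2)+m$ if $d=m$.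
   Context: $R$ is graded in the standard way ($\deg x_i=1$), and $\lceil a\rceil$ denotes the smallest integer $\ge a$. For a homogeneous ideal $I\subseteq R$, $\beta_{i,j}(I)$ denotes the $(i,j)$-th graded Betti number of $I$ viewed as an $R$-module, i.e. the number of copies of $R(-j)$ in homological degree $i$ of the minimal graded free resolution of $I$ over $R$. The projective dimension is $\mathrm{pd}(I)=\max\{i : \beta_{i,j}(I)\neq 0 \text{ for some } j\}$ and the (Castelnuovo-Mumford) regularity is $\mathrm{reg}(I)=\max\{j-i : \beta_{i,j}(I)\neq 0\}$. These are invariants of the ideal $I$ as a module, not of $R/I$. *)

theory Defs
  imports Complex_Main "HOL-Library.Poly_Mapping" "HOL-Algebra.Ideal"
begin

section \<open>The polynomial ring \<open>K[x\<^sub>1, \<dots>, x\<^sub>n]\<close> with its standard grading\<close>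

text \<open>
  Monomials are exponent functions \<open>nat \<Rightarrow>\<^sub>0 nat\<close> and polynomials are finitely supported functions
  from monomials to coefficients, with the convolution product of \<^theory>\<open>HOL-Library.Poly_Mapping\<close>.
  The ring \<open>K[x\<^sub>1, \<dots>, x\<^sub>n]\<close> consists of those involving only variables with index in \<open>{1..n}\<close>.
\<close>

type_synonym 'a mpoly = "(nat \<Rightarrow>\<^sub>0 nat) \<Rightarrow>\<^sub>0 'a"

definition mpoly_ring :: "nat \<Rightarrow> 'a::field mpoly ring" where
  "mpoly_ring n =
    \<lparr>carrier = {p. \<forall>t\<in>Poly_Mapping.keys p. Poly_Mapping.keys t \<subseteq> {1..n}},
     mult = (*), one = 1, zero = 0, add = (+)\<rparr>"

definition X :: "nat \<Rightarrow> 'a::field mpoly" where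
  "X i = Poly_Mapping.single (Poly_Mapping.single i 1) 1"

definition mon_deg :: "(nat \<Rightarrow>\<^sub>0 nat) \<Rightarrow> nat" where
  "mon_deg t = (\<Sum>v\<in>Poly_Mapping.keys t. Poly_Mapping.lookup t v)"

text \<open>The zero polynomial is homogeneous of every degree, and is the only one of negative degree.\<close>

definition homogeneous :: "'a::field mpoly \<Rightarrow> int \<Rightarrow> bool" where
  "homogeneous p d \<longleftrightarrow> (\<forall>t\<in>Poly_Mapping.keys p. int (mon_deg t) = d)"

lemma cring_mpoly_ring: "cring (mpoly_ring n :: 'a::field mpoly ring)"
proof (rule cringI)
  let ?R = "mpoly_ring n :: 'a mpoly ring"
  have add: "p + q \<in> carrier ?R" if "p \<in> carrier ?R" "q \<in> carrier ?R" for p q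
    using that Poly_Mapping.keys_add[of p q] by (simp add: mpoly_ring_def) blast
  have mult: "p * q \<in> carrier ?R" if "p \<in> carrier ?R" "q \<in> carrier ?R" for p q
  proof -
    have "Poly_Mapping.keys t \<subseteq> {1..n}" if t: "t \<in> Poly_Mapping.keys (p * q)" for t
    proof -
      from t keys_mult[of p q] obtain a b
        where "t = a + b" "a \<in> Poly_Mapping.keys p" "b \<in> Poly_Mapping.keys q"
        by blast
      moreover from this have "Poly_Mapping.keys a \<subseteq> {1..n}" "Poly_Mapping.keys b \<subseteq> {1..n}"
        using \<open>p \<in> carrier ?R\<close> \<open>q \<in> carrier ?R\<close> by (simp_all add: mpoly_ring_def)
      ultimately show ?thesis
        using Poly_Mapping.keys_add[of a b] by blast
    qed
    then show ?thesis by (simp add: mpoly_ring_def)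
  qed
  have uminus: "- p \<in> carrier ?R" if "p \<in> carrier ?R" for p
    using that by (simp add: mpoly_ring_def)
  have ops: "(\<otimes>\<^bsub>?R\<^esub>) = (*)" "(\<oplus>\<^bsub>?R\<^esub>) = (+)" "\<one>\<^bsub>?R\<^esub> = 1" "\<zero>\<^bsub>?R\<^esub> = 0"
    by (simp_all add: mpoly_ring_def)
  have zero: "0 \<in> carrier ?R" and one: "1 \<in> carrier ?R"
    by (simp_all add: mpoly_ring_def)
  show "abelian_group ?R"
  proof (rule abelian_groupI, unfold ops)
    fix p assume "p \<in> carrier ?R"
    then show "\<exists>q\<in>carrier ?R. q + p = 0"
      using uminus by (intro bexI[of _ "- p"]) simp_all
  qed (simp_all only: add zero add.assoc add.left_neutral, rule add.commute)
  show "comm_monoid ?R"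
    by (rule comm_monoidI, unfold ops)
      (simp_all only: mult one mult.assoc mult_1_left, rule mult.commute)
qed (simp add: mpoly_ring_def distrib_right)


section \<open>Minimal graded free resolutions\<close>

text \<open>
  A graded free resolution \<open>\<dots> \<rightarrow> F\<^sub>1 \<rightarrow> F\<^sub>0 \<rightarrow> I \<rightarrow> 0\<close> of an ideal \<open>I\<close>
  of \<open>R = K[x\<^sub>1, \<dots>, x\<^sub>n]\<close> is described by the following data:
  \<open>F\<^sub>i\<close> is the direct sum of the \<open>R(- gshift i a)\<close> for \<open>a < frank i\<close>;
  \<open>aug a \<in> I\<close> is the image of the basis vector \<open>e\<^sub>a\<close> of \<open>F\<^sub>0\<close>;
  and \<open>bdry i\<close> is the matrix of \<open>F\<^bsub>i+1\<^esub> \<rightarrow> F\<^sub>i\<close>, whose row \<open>bdry i a\<close> is the image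
  of the basis vector \<open>e\<^sub>a\<close> of \<open>F\<^bsub>i+1\<^esub>\<close>.
\<close>

record (overloaded) 'a gfree_complex =
  frank :: "nat \<Rightarrow> nat"
  gshift :: "nat \<Rightarrow> nat \<Rightarrow> int"
  aug :: "nat \<Rightarrow> 'a mpoly"
  bdry :: "nat \<Rightarrow> nat \<Rightarrow> nat \<Rightarrow> 'a mpoly"

text \<open>The free module \<open>R\<^sup>r\<close>; vectors are extended by zero beyond their first \<open>r\<close> entries.\<close>

definition free_mod :: "nat \<Rightarrow> nat \<Rightarrow> (nat \<Rightarrow> 'a::field mpoly) set" where
  "free_mod n r = {v. (\<forall>a<r. v a \<in> carrier (mpoly_ring n)) \<and> (\<forall>a\<ge>r. v a = 0)}"

definition aug_map :: "'a::field gfree_complex \<Rightarrow> (nat \<Rightarrow> 'a mpoly) \<Rightarrow> 'a mpoly" where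
  "aug_map F v = (\<Sum>a<frank F 0. v a * aug F a)"

definition bdry_map :: "'a::field gfree_complex \<Rightarrow> nat \<Rightarrow> (nat \<Rightarrow> 'a mpoly) \<Rightarrow> nat \<Rightarrow> 'a mpoly" where
  "bdry_map F i v = (\<lambda>b. \<Sum>a<frank F (Suc i). v a * bdry F i a b)"

text \<open>
  A graded free resolution: all maps are homogeneous of degree 0, and the augmented complex is exact.
\<close>

definition graded_free_resolution :: "nat \<Rightarrow> 'a::field mpoly set \<Rightarrow> 'a gfree_complex \<Rightarrow> bool" where
  "graded_free_resolution n I F \<longleftrightarrow>
     (\<forall>a<frank F 0. aug F a \<in> carrier (mpoly_ring n) \<and> homogeneous (aug F a) (gshift F 0 a)) \<and>
     (\<forall>i. \<forall>a<frank F (Suc i). bdry F i a \<in> free_mod n (frank F i) \<and>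
        (\<forall>b<frank F i. homogeneous (bdry F i a b) (gshift F (Suc i) a - gshift F i b))) \<and>
     aug_map F ` free_mod n (frank F 0) = I \<and>
     {v \<in> free_mod n (frank F 0). aug_map F v = 0} =
       bdry_map F 0 ` free_mod n (frank F (Suc 0)) \<and>
     (\<forall>i. {v \<in> free_mod n (frank F (Suc i)). bdry_map F i v = (\<lambda>_. 0)} =
       bdry_map F (Suc i) ` free_mod n (frank F (Suc (Suc i))))"

text \<open>
  Minimality: every boundary map sends \<open>F\<^bsub>i+1\<^esub>\<close> into \<open>(x\<^sub>1, \<dots>, x\<^sub>n) F\<^sub>i\<close>, that is, all matrix
  entries have zero constant term.
\<close>

definition minimal_graded_free_resolution ::
    "nat \<Rightarrow> 'a::field mpoly set \<Rightarrow> 'a gfree_complex \<Rightarrow> bool" where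
  "minimal_graded_free_resolution n I F \<longleftrightarrow> graded_free_resolution n I F \<and>
     (\<forall>i. \<forall>a<frank F (Suc i). \<forall>b<frank F i. Poly_Mapping.lookup (bdry F i a b) 0 = 0)"


section \<open>Betti numbers, projective dimension and regularity\<close>

text \<open>
  A homogeneous ideal has a minimal graded free resolution, unique up to isomorphism, so the
  choice made here does not matter.  The ideal \<open>I\<close> itself, not \<open>R/I\<close>, is being resolved.
\<close>

definition betti :: "nat \<Rightarrow> 'a::field mpoly set \<Rightarrow> nat \<Rightarrow> int \<Rightarrow> nat" where
  "betti n I i j =
     (let F = (SOME F. minimal_graded_free_resolution n I F)
      in card {a. a < frank F i \<and> gshift F i a = j})"

definition proj_dim :: "nat \<Rightarrow> 'a::field mpoly set \<Rightarrow> nat" where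
  "proj_dim n I = Max {i. \<exists>j. betti n I i j \<noteq> 0}"

definition regularity :: "nat \<Rightarrow> 'a::field mpoly set \<Rightarrow> int" where
  "regularity n I = Max {j - int i | i j. betti n I i j \<noteq> 0}"


section \<open>The path ideals\<close>

definition path_gen :: "nat \<Rightarrow> nat \<Rightarrow> nat \<Rightarrow> 'a::field mpoly" where
  "path_gen m l i = (\<Prod>j=1..m. X ((i - 1) * (m - l) + j))"

text \<open>The ambient ring has \<open>n = k (m - l) + l\<close> variables.\<close>

definition path_ideal :: "nat \<Rightarrow> nat \<Rightarrow> nat \<Rightarrow> 'a::field mpoly set" where
  "path_ideal m l k = Idl\<^bsub>mpoly_ring (k * (m - l) + l)\<^esub> (path_gen m l ` {1..k})"

end

theory Submission
  imports Defs
begin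

text \<open>
  Since \<open>m - l\<close> divides \<open>m\<close>, put \<open>c = m - l\<close>, \<open>m = q c\<close> and cut the variables into blocks of length \<open>c\<close>:
  each generator is the product of \<open>q\<close> consecutive blocks. Let \<open>I\<^sub>k\<close> be the ideal of the
  first \<open>k\<close> generators and \<open>B\<close> the last block of \<open>u\<^bsub>k+1\<^esub> = B u'\<close>. As \<open>I\<^sub>k\<close> does not
  involve \<open>B\<close>, the colon ideals by \<open>u\<^bsub>k+1\<^esub>\<close> and by \<open>u'\<close> agree, both being \<open>I\<^bsub>k-q\<^esub>\<close> plus the
  block preceding \<open>u\<^bsub>k+1\<^esub>\<close>. The mapping cone over \<open>B\<close> times a lift of multiplication by \<open>u'\<close> is therefore
  minimal, which gives a recursion for the positions of the nonzero Betti numbers. A chain endomorphism over the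
  identity is homotopic to the identity, so these positions do not depend on the minimal resolution.
\<close>

section \<open>Graded polynomials and free modules\<close>

text \<open>The factor \<open>B\<close> is what keeps the cone minimal: the block preceding u_{k+1},
  multiplied by u', is exactly u_k. A lift of multiplication by u' therefore sends the basis vector
  of that block to a combination with a unit coefficient, and only the multiplication by
  \<open>B\<close> removes such constant terms. Since every cone is minimal, nothing cancels, and
  the positions of the cone are the union of those of its two parts. Multiplicities are not
  recorded, because projective dimension and regularity depend only on which Betti numbers vanish.
  Resolutions are built for R/I instead of I: the copy of R in front is where multiplication by u'
  is prescribed as a map, and it makes all indices one higher than those of \<open>betti\<close>.
  Each generator contributes two nested cones, one of degree m for the generator and one of degree c
  for the block. Together they raise the homological index by 2 and the degree by m + c = 2m - l,
  which is the divisor of n in the theorem. Both maxima are reached by repeating this double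
  step.\<close>

abbreviation poly_carrier :: "nat \<Rightarrow> 'a::field mpoly set" where
  "poly_carrier n \<equiv> carrier (mpoly_ring n)"

lemma in_poly_carrier_iff:
  "p \<in> poly_carrier n \<longleftrightarrow> (\<forall>t\<in>Poly_Mapping.keys p. Poly_Mapping.keys t \<subseteq> {1..n})"
  by (simp add: mpoly_ring_def)

lemma poly_carrier_0 [simp]: "0 \<in> poly_carrier n"
  and poly_carrier_1 [simp]: "1 \<in> poly_carrier n"
  by (simp_all add: in_poly_carrier_iff)

lemma poly_carrier_add [intro, simp]:
  assumes "p \<in> poly_carrier n" "q \<in> poly_carrier n"
  shows "p + q \<in> poly_carrier n"
  using assms Poly_Mapping.keys_add[of p q] unfolding in_poly_carrier_iff by blast

lemma poly_carrier_uminus [intro, simp]: "p \<in> poly_carrier n \<Longrightarrow> - p \<in> poly_carrier n"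
  by (simp add: in_poly_carrier_iff)

lemma poly_carrier_diff [intro, simp]:
  "p \<in> poly_carrier n \<Longrightarrow> q \<in> poly_carrier n \<Longrightarrow> p - q \<in> poly_carrier n"
  using poly_carrier_add[of p n "- q"] by simp

lemma poly_carrier_mult [intro, simp]:
  assumes "p \<in> poly_carrier n" "q \<in> poly_carrier n"
  shows "p * q \<in> poly_carrier n"
proof -
  interpret cring "mpoly_ring n :: 'a mpoly ring" by (rule cring_mpoly_ring)
  show ?thesis
    using m_closed[OF assms] by (simp add: mpoly_ring_def)
qed

lemma poly_carrier_sum [intro, simp]:
  "(\<And>a. a \<in> A \<Longrightarrow> f a \<in> poly_carrier n) \<Longrightarrow> sum f A \<in> poly_carrier n"
  by (induction A rule: infinite_finite_induct) auto

section \<open>Degrees, homogeneous polynomials and constant terms\<close>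

lemma mon_deg_eq_sum:
  assumes "finite A" "Poly_Mapping.keys t \<subseteq> A"
  shows "mon_deg t = (\<Sum>v\<in>A. Poly_Mapping.lookup t v)"
  unfolding mon_deg_def using assms
  by (intro sum.mono_neutral_left) (auto simp: in_keys_iff)

lemma mon_deg_add: "mon_deg (t + u) = mon_deg t + mon_deg u"
proof -
  let ?A = "Poly_Mapping.keys t \<union> Poly_Mapping.keys u"
  have "Poly_Mapping.keys (t + u) \<subseteq> ?A" by (rule Poly_Mapping.keys_add)
  then show ?thesis
    by (simp add: mon_deg_eq_sum[of ?A] lookup_add sum.distrib)
qed

lemma mon_deg_0 [simp]: "mon_deg 0 = 0"
  by (simp add: mon_deg_def)

lemma homogeneous_0 [simp]: "homogeneous 0 d"
  by (simp add: homogeneous_def)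

lemma homogeneous_1 [simp]: "homogeneous 1 0"
  by (simp add: homogeneous_def)

lemma homogeneous_uminus [intro]: "homogeneous p d \<Longrightarrow> homogeneous (- p) d"
  by (simp add: homogeneous_def)

lemma homogeneous_add [intro]:
  "homogeneous p d \<Longrightarrow> homogeneous q d \<Longrightarrow> homogeneous (p + q) d"
  using Poly_Mapping.keys_add[of p q] unfolding homogeneous_def by blast

lemma homogeneous_sum [intro]:
  "(\<And>a. a \<in> A \<Longrightarrow> homogeneous (f a) d) \<Longrightarrow> homogeneous (sum f A) d"
  by (induction A rule: infinite_finite_induct) auto

lemma homogeneous_mult:
  assumes "homogeneous p d" "homogeneous q e"
  shows "homogeneous (p * q) (d + e)"
  unfolding homogeneous_def
proof
  fix t assume "t \<in> Poly_Mapping.keys (p * q)"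
  then obtain a b where "t = a + b" "a \<in> Poly_Mapping.keys p" "b \<in> Poly_Mapping.keys q"
    using keys_mult[of p q] by blast
  with assms show "int (mon_deg t) = d + e"
    by (auto simp: homogeneous_def mon_deg_add)
qed

lemma lookup_zero_homogeneous:
  "homogeneous p d \<Longrightarrow> d \<noteq> 0 \<Longrightarrow> Poly_Mapping.lookup p 0 = 0"
  unfolding homogeneous_def by (metis in_keys_iff mon_deg_0 of_nat_0)

lemma monom_add_eq_0_iff: "t + u = 0 \<longleftrightarrow> t = 0 \<and> u = 0" for t u :: "nat \<Rightarrow>\<^sub>0 nat"
  by (auto simp: poly_mapping_eq_iff fun_eq_iff lookup_add)

text \<open>Exponent functions add up to zero only as 0 + 0, so the constant coefficient is
  multiplicative. Matrix products can thus be reduced modulo (x_1, ..., x_n) entry by entry.\<close>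

lemma lookup_zero_mult:
  "Poly_Mapping.lookup (p * q) 0 = Poly_Mapping.lookup p 0 * Poly_Mapping.lookup q 0"
  for p q :: "'a::field mpoly"
proof -
  have "(0 = t + u) = (t = 0 \<and> u = 0)" for t u :: "nat \<Rightarrow>\<^sub>0 nat"
    using monom_add_eq_0_iff[of t u] by auto
  then have eq: "(a when 0 = t + u) = ((a when u = 0) when t = 0)" for a :: 'a and t u :: "nat \<Rightarrow>\<^sub>0 nat"
    by (auto simp: when_def)
  show ?thesis
    unfolding lookup_mult eq Sum_any_when_independent mult_when Sum_any_when_equal ..
qed

text \<open>One operator serves two decompositions: into homogeneous components, where
  \<open>A\<close> is a degree class, and into the terms inside and outside a monomial
  ideal.\<close>

definition poly_part :: "(nat \<Rightarrow>\<^sub>0 nat) set \<Rightarrow> 'a::field mpoly \<Rightarrow> 'a mpoly" where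
  "poly_part A p = (\<Sum>t\<in>Poly_Mapping.keys p \<inter> A. Poly_Mapping.single t (Poly_Mapping.lookup p t))"

lemma lookup_poly_part:
  "Poly_Mapping.lookup (poly_part A p) t = (if t \<in> A then Poly_Mapping.lookup p t else 0)"
proof -
  have "Poly_Mapping.lookup (poly_part A p) t =
      (\<Sum>u\<in>Poly_Mapping.keys p \<inter> A. if t = u then Poly_Mapping.lookup p t else 0)"
    unfolding poly_part_def lookup_sum
    by (intro sum.cong) (auto simp: lookup_single when_def)
  then show ?thesis
    by (auto simp: in_keys_iff)
qed

lemma keys_poly_part: "Poly_Mapping.keys (poly_part A p) = Poly_Mapping.keys p \<inter> A"
  by (auto simp: in_keys_iff lookup_poly_part split: if_splits)

lemma poly_part_add: "poly_part A (p + q) = poly_part A p + poly_part A q"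
  by (rule poly_mapping_eqI) (simp add: lookup_poly_part lookup_add)

lemma poly_part_0 [simp]: "poly_part A 0 = 0"
  by (simp add: poly_part_def)

lemma poly_part_sum: "poly_part A (sum f B) = (\<Sum>b\<in>B. poly_part A (f b))"
  by (induction B rule: infinite_finite_induct) (simp_all add: poly_part_add)

lemma poly_part_split: "poly_part A p + poly_part (- A) p = p"
  by (rule poly_mapping_eqI) (simp add: lookup_poly_part lookup_add)

lemma poly_part_eq_self: "Poly_Mapping.keys p \<subseteq> A \<Longrightarrow> poly_part A p = p"
  by (rule poly_mapping_eqI) (auto simp: lookup_poly_part in_keys_iff)

lemma poly_part_eq_0: "Poly_Mapping.keys p \<inter> A = {} \<Longrightarrow> poly_part A p = 0"
  by (simp add: poly_part_def)

lemma poly_carrier_part [intro, simp]: "p \<in> poly_carrier n \<Longrightarrow> poly_part A p \<in> poly_carrier n"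
  by (simp add: in_poly_carrier_iff keys_poly_part)

abbreviation deg_part :: "int \<Rightarrow> 'a::field mpoly \<Rightarrow> 'a mpoly" where
  "deg_part d \<equiv> poly_part {t. int (mon_deg t) = d}"

lemma homogeneous_deg_part [simp]: "homogeneous (deg_part d p) d"
  by (simp add: homogeneous_def keys_poly_part)

lemma deg_part_homogeneous: "homogeneous p d \<Longrightarrow> deg_part d p = p"
  by (rule poly_part_eq_self) (auto simp: homogeneous_def)

text \<open>A homogeneous factor raises every degree by \<open>e\<close>, so the terms of
  \<open>p\<close> outside degree \<open>d\<close> contribute nothing in degree
  \<open>d + e\<close>.\<close>

lemma deg_part_mult:
  assumes "homogeneous q e"
  shows "deg_part (d + e) (p * q) = deg_part d p * q"
proof -
  let ?p = "poly_part (- {t. int (mon_deg t) = d}) p"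
  have "p * q = deg_part d p * q + ?p * q"
    by (simp only: poly_part_split flip: distrib_right)
  moreover have "deg_part (d + e) (deg_part d p * q) = deg_part d p * q"
    using assms by (intro deg_part_homogeneous homogeneous_mult) simp_all
  moreover have "deg_part (d + e) (?p * q) = 0"
  proof (rule poly_part_eq_0, safe)
    fix t assume t: "t \<in> Poly_Mapping.keys (?p * q)" "int (mon_deg t) = d + e"
    then obtain a b where "t = a + b" "a \<in> Poly_Mapping.keys ?p" "b \<in> Poly_Mapping.keys q"
      using keys_mult[of ?p q] by blast
    with assms t(2) show "t \<in> {}"
      by (auto simp: homogeneous_def mon_deg_add keys_poly_part)
  qed
  ultimately show ?thesis
    by (metis add.right_neutral poly_part_add)
qed

section \<open>Vectors over the polynomial ring and matrices acting on rows\<close>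

lemma free_mod_carrier: "v \<in> free_mod n r \<Longrightarrow> v a \<in> poly_carrier n"
  by (cases "a < r") (auto simp: free_mod_def)

lemma free_mod_beyond: "v \<in> free_mod n r \<Longrightarrow> r \<le> a \<Longrightarrow> v a = 0"
  by (auto simp: free_mod_def)

lemma free_modI:
  "(\<And>a. a < r \<Longrightarrow> v a \<in> poly_carrier n) \<Longrightarrow> (\<And>a. r \<le> a \<Longrightarrow> v a = 0) \<Longrightarrow> v \<in> free_mod n r"
  by (auto simp: free_mod_def)

lemma free_mod_0: "(\<lambda>_. 0) \<in> free_mod n r"
  by (simp add: free_mod_def)

lemma free_mod_add: "v \<in> free_mod n r \<Longrightarrow> w \<in> free_mod n r \<Longrightarrow> (\<lambda>a. v a + w a) \<in> free_mod n r"
  by (simp add: free_mod_def)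

lemma free_mod_diff: "v \<in> free_mod n r \<Longrightarrow> w \<in> free_mod n r \<Longrightarrow> (\<lambda>a. v a - w a) \<in> free_mod n r"
  by (simp add: free_mod_def)

lemma free_mod_uminus: "v \<in> free_mod n r \<Longrightarrow> (\<lambda>a. - v a) \<in> free_mod n r"
  by (simp add: free_mod_def)

lemma free_mod_smult:
  "c \<in> poly_carrier n \<Longrightarrow> v \<in> free_mod n r \<Longrightarrow> (\<lambda>a. c * v a) \<in> free_mod n r"
  by (simp add: free_mod_def)

definition basis_vec :: "nat \<Rightarrow> nat \<Rightarrow> 'a::field mpoly" where
  "basis_vec a = (\<lambda>b. if b = a then 1 else 0)"

lemma free_mod_basis_vec: "a < r \<Longrightarrow> basis_vec a \<in> free_mod n r"
  by (auto simp: free_mod_def basis_vec_def)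

text \<open>Matrices act on row vectors from the right: row \<open>a\<close> is the image of the
  basis vector \<open>a\<close>, as in \<open>bdry\<close>, and composites are read from left to
  right. The argument \<open>r\<close> is the rank of the source.\<close>

definition row_mult ::
    "nat \<Rightarrow> (nat \<Rightarrow> 'a::field mpoly) \<Rightarrow> (nat \<Rightarrow> nat \<Rightarrow> 'a mpoly) \<Rightarrow> nat \<Rightarrow> 'a mpoly" where
  "row_mult r v M = (\<lambda>b. \<Sum>a<r. v a * M a b)"

lemma row_mult_cong:
  "(\<And>a. a < r \<Longrightarrow> v a = w a) \<Longrightarrow> (\<And>a. a < r \<Longrightarrow> M a = N a) \<Longrightarrow> row_mult r v M = row_mult r w N"
  by (simp add: row_mult_def)

lemma row_mult_assoc:
  "row_mult r (row_mult q v M) N = row_mult q v (\<lambda>a. row_mult r (M a) N)"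
  unfolding row_mult_def sum_distrib_left sum_distrib_right
  by (rule ext, subst sum.swap) (simp add: mult.assoc)

lemma row_mult_free_mod:
  assumes "\<And>a. a < r \<Longrightarrow> v a \<in> poly_carrier n" "\<And>a. a < r \<Longrightarrow> M a \<in> free_mod n q"
  shows "row_mult r v M \<in> free_mod n q"
proof (rule free_modI)
  show "row_mult r v M a \<in> poly_carrier n" for a
    unfolding row_mult_def using assms free_mod_carrier by fast
  show "row_mult r v M a = 0" if "q \<le> a" for a
    using free_mod_beyond[OF assms(2) that] by (simp add: row_mult_def)
qed

lemma row_mult_add: "row_mult r (\<lambda>a. v a + w a) M = (\<lambda>b. row_mult r v M b + row_mult r w M b)"
  by (simp add: row_mult_def distrib_right sum.distrib)

lemma row_mult_diff: "row_mult r (\<lambda>a. v a - w a) M = (\<lambda>b. row_mult r v M b - row_mult r w M b)"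
  by (simp add: row_mult_def left_diff_distrib sum_subtractf)

lemma row_mult_uminus: "row_mult r (\<lambda>a. - v a) M = (\<lambda>b. - row_mult r v M b)"
  by (simp add: row_mult_def sum_negf)

lemma row_mult_smult: "row_mult r (\<lambda>a. c * v a) M = (\<lambda>b. c * row_mult r v M b)"
  by (simp add: row_mult_def sum_distrib_left mult.assoc)

lemma row_mult_diff_right: "row_mult r v (\<lambda>a b. M a b - N a b) = (\<lambda>b. row_mult r v M b - row_mult r v N b)"
  by (simp add: row_mult_def right_diff_distrib sum_subtractf)

lemma row_mult_0 [simp]: "row_mult r (\<lambda>_. 0) M = (\<lambda>_. 0)"
  and row_mult_0_right [simp]: "row_mult r v (\<lambda>_ _. 0) = (\<lambda>_. 0)"
  by (simp_all add: row_mult_def)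

lemma row_mult_basis_vec: "a < r \<Longrightarrow> row_mult r (basis_vec a) M = M a"
  by (simp add: row_mult_def basis_vec_def if_distrib[of "\<lambda>x. x * _"] cong: if_cong)

lemma row_mult_id:
  assumes "v \<in> free_mod n r"
  shows "row_mult r v basis_vec = v"
proof
  fix b
  have "row_mult r v basis_vec b = (\<Sum>a<r. if a = b then v a else 0)"
    unfolding row_mult_def basis_vec_def by (intro sum.cong) auto
  with assms show "row_mult r v basis_vec b = v b"
    by (auto simp: free_mod_beyond)
qed

lemma homogeneous_row_mult:
  assumes "\<And>a. a < r \<Longrightarrow> homogeneous (v a) (d - s a)" "\<And>a. a < r \<Longrightarrow> homogeneous (M a b) (s a - e)"
  shows "homogeneous (row_mult r v M b) (d - e)"
  unfolding row_mult_def
proof (rule homogeneous_sum)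
  fix a assume "a \<in> {..<r}"
  then show "homogeneous (v a * M a b) (d - e)"
    using homogeneous_mult[OF assms(1)[of a] assms(2)[of a]] by simp
qed

section \<open>Resolutions and comparison of resolutions\<close>

text \<open>This is a minimal graded free resolution of R/J: index 0 is R itself in degree 0, and
  \<open>D 0\<close> is the column of generators of \<open>J\<close>. Treating the augmentation as a
  differential lets the comparison and cone arguments treat all indices alike.\<close>

locale aug_resolution =
  fixes n :: nat and J :: "'a::field mpoly set" and r :: "nat \<Rightarrow> nat" and s :: "nat \<Rightarrow> nat \<Rightarrow> int"
    and D :: "nat \<Rightarrow> nat \<Rightarrow> nat \<Rightarrow> 'a mpoly"
  assumes rank_0: "r 0 = 1" and shift_0: "s 0 0 = 0"
    and D_free_mod: "a < r (Suc i) \<Longrightarrow> D i a \<in> free_mod n (r i)"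
    and D_homogeneous: "a < r (Suc i) \<Longrightarrow> b < r i \<Longrightarrow> homogeneous (D i a b) (s (Suc i) a - s i b)"
    and D_minimal: "a < r (Suc i) \<Longrightarrow> b < r i \<Longrightarrow> Poly_Mapping.lookup (D i a b) 0 = 0"
    and exact_0: "(\<lambda>v. row_mult (r (Suc 0)) v (D 0)) ` free_mod n (r (Suc 0)) =
      {v \<in> free_mod n (r 0). v 0 \<in> J}"
    and exact_Suc: "(\<lambda>v. row_mult (r (Suc (Suc i))) v (D (Suc i))) ` free_mod n (r (Suc (Suc i))) =
      {v \<in> free_mod n (r (Suc i)). row_mult (r (Suc i)) v (D i) = (\<lambda>_. 0)}"
begin

text \<open>Merges the two exactness axioms: at index 0 the kernel of the projection from R to R/J
  stands in for the kernel of a preceding differential.\<close>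

definition cycles :: "nat \<Rightarrow> (nat \<Rightarrow> 'a mpoly) set" where
  "cycles i = {v \<in> free_mod n (r i).
     case i of 0 \<Rightarrow> v 0 \<in> J | Suc i' \<Rightarrow> row_mult (r i) v (D i') = (\<lambda>_. 0)}"

lemma exact: "(\<lambda>v. row_mult (r (Suc i)) v (D i)) ` free_mod n (r (Suc i)) = cycles i"
  using exact_0 exact_Suc by (cases i) (simp_all add: cycles_def)

lemma cyclesE:
  assumes "v \<in> cycles i"
  obtains w where "w \<in> free_mod n (r (Suc i))" "row_mult (r (Suc i)) w (D i) = v"
  using assms unfolding exact[symmetric] by blast

lemma row_mult_D_cycle: "w \<in> free_mod n (r (Suc i)) \<Longrightarrow> row_mult (r (Suc i)) w (D i) \<in> cycles i"
  unfolding exact[symmetric] by blast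

lemma row_mult_D_free_mod: "w \<in> free_mod n (r (Suc i)) \<Longrightarrow> row_mult (r (Suc i)) w (D i) \<in> free_mod n (r i)"
  using D_free_mod by (intro row_mult_free_mod) (auto intro: free_mod_carrier)

lemma row_mult_D_D:
  "w \<in> free_mod n (r (Suc (Suc i))) \<Longrightarrow>
    row_mult (r (Suc i)) (row_mult (r (Suc (Suc i))) w (D (Suc i))) (D i) = (\<lambda>_. 0)"
  using row_mult_D_cycle[of w "Suc i"] by (simp add: cycles_def)

lemma row_mult_D_row: "a < r (Suc (Suc i)) \<Longrightarrow> row_mult (r (Suc i)) (D (Suc i) a) (D i) = (\<lambda>_. 0)"
  using row_mult_D_D[OF free_mod_basis_vec, of a i] by (simp add: row_mult_basis_vec)

lemma D_0_in_ideal: "a < r (Suc 0) \<Longrightarrow> D 0 a \<in> cycles 0"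
  using row_mult_D_cycle[OF free_mod_basis_vec, of a 0] by (simp add: row_mult_basis_vec)

text \<open>Exactness gives some preimage. Since \<open>D i\<close> preserves degrees, replacing
  each coordinate by its component of the expected degree gives another one.\<close>

lemma homogeneous_cyclesE:
  assumes v: "v \<in> cycles i" and hom: "\<And>b. b < r i \<Longrightarrow> homogeneous (v b) (d - s i b)"
  obtains w where "w \<in> free_mod n (r (Suc i))" "row_mult (r (Suc i)) w (D i) = v"
    "\<And>a. a < r (Suc i) \<Longrightarrow> homogeneous (w a) (d - s (Suc i) a)"
proof -
  obtain w where w: "w \<in> free_mod n (r (Suc i))" "row_mult (r (Suc i)) w (D i) = v"
    using v by (rule cyclesE)
  let ?w = "\<lambda>a. deg_part (d - s (Suc i) a) (w a)"
  have free: "?w \<in> free_mod n (r (Suc i))"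
    using w(1) by (intro free_modI) (auto intro: free_mod_carrier simp: free_mod_beyond)
  have "row_mult (r (Suc i)) ?w (D i) b = v b" for b
  proof (cases "b < r i")
    case True
    have "v b = deg_part (d - s i b) (v b)"
      using hom[OF True] by (simp add: deg_part_homogeneous)
    also have "\<dots> = (\<Sum>a<r (Suc i). deg_part (d - s i b) (w a * D i a b))"
      by (simp add: poly_part_sum row_mult_def flip: w(2))
    also have "\<dots> = (\<Sum>a<r (Suc i). ?w a * D i a b)"
    proof (intro sum.cong refl)
      fix a assume "a \<in> {..<r (Suc i)}"
      then show "deg_part (d - s i b) (w a * D i a b) = ?w a * D i a b"
        using deg_part_mult[OF D_homogeneous[of a i b], of "d - s (Suc i) a" "w a"] True by simp
    qed
    finally show ?thesis
      by (simp add: row_mult_def)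
  next
    case False
    moreover have "v \<in> free_mod n (r i)"
      using v by (simp add: cycles_def)
    ultimately show ?thesis
      using row_mult_D_free_mod[OF free] by (simp add: free_mod_beyond)
  qed
  then show ?thesis
    using free by (intro that[of ?w]) auto
qed

end

text \<open>The comparison theorem with a degree shift \<open>e\<close>: rows are lifted one index
  at a time through the exactness of the resolution of R/J. It is applied with \<open>u = 1\<close>
  to compare two resolutions of the same quotient, and with a monomial \<open>u\<close> to build
  cones.\<close>

lemma lift_multiplication:
  assumes C: "aug_resolution n C rC sC DC" and J: "aug_resolution n J rJ sJ DJ"
    and u: "u \<in> poly_carrier n" "homogeneous u e" and CJ: "\<And>p. p \<in> C \<Longrightarrow> p * u \<in> J"
  obtains A where "A 0 = (\<lambda>a b. if b = 0 then u else 0)"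
    "\<And>i a. a < rC i \<Longrightarrow> A i a \<in> free_mod n (rJ i)"
    "\<And>i a b. a < rC i \<Longrightarrow> b < rJ i \<Longrightarrow> homogeneous (A i a b) (sC i a + e - sJ i b)"
    "\<And>i a. a < rC (Suc i) \<Longrightarrow>
      row_mult (rJ (Suc i)) (A (Suc i) a) (DJ i) = row_mult (rC i) (DC i a) (A i)"
proof -
  interpret C: aug_resolution n C rC sC DC by (rule C)
  interpret J: aug_resolution n J rJ sJ DJ by (rule J)
  let ?A0 = "\<lambda>a b. if b = (0::nat) then u else 0"
  \<comment> \<open>\<open>P\<close> is the invariant of one level; its last clause says that the
    rows of the next level can be lifted. \<open>Q\<close> is the commuting square between
    consecutive levels.\<close>
  define P where "P i M \<longleftrightarrow> (i = 0 \<longrightarrow> M = ?A0) \<and> (\<forall>a<rC i. M a \<in> free_mod n (rJ i)) \<and>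
    (\<forall>a<rC i. \<forall>b<rJ i. homogeneous (M a b) (sC i a + e - sJ i b)) \<and>
    (\<forall>a<rC (Suc i). row_mult (rC i) (DC i a) M \<in> J.cycles i)" for i M
  define Q where "Q i M N \<longleftrightarrow> (\<forall>a<rC (Suc i).
      row_mult (rJ (Suc i)) (N a) (DJ i) = row_mult (rC i) (DC i a) M)" for i M N
  have "\<exists>A. \<forall>i. P i (A i) \<and> Q i (A i) (A (Suc i))"
  proof (rule dependent_nat_choice)
    have "row_mult 1 (DC 0 a) ?A0 \<in> J.cycles 0" if "a < rC (Suc 0)" for a
      using C.D_0_in_ideal[OF that] CJ u(1)
      by (auto simp: C.cycles_def J.cycles_def J.rank_0 C.rank_0 row_mult_def free_mod_def)
    then have "P 0 ?A0"
      using u by (auto simp: P_def C.rank_0 J.rank_0 C.shift_0 J.shift_0 free_mod_def)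
    then show "\<exists>M. P 0 M" by blast
  next
    fix M i assume M: "P i M"
    have "\<exists>w. w \<in> free_mod n (rJ (Suc i)) \<and>
        row_mult (rJ (Suc i)) w (DJ i) = row_mult (rC i) (DC i a) M \<and>
        (\<forall>b<rJ (Suc i). homogeneous (w b) (sC (Suc i) a + e - sJ (Suc i) b))"
      if a: "a < rC (Suc i)" for a
    proof -
      have hom: "homogeneous (row_mult (rC i) (DC i a) M b) (sC (Suc i) a + e - sJ i b)" if "b < rJ i" for b
      proof -
        have "homogeneous (M c b) (sC i c - (sJ i b - e))" if "c < rC i" for c
          using M that \<open>b < rJ i\<close> by (simp add: P_def algebra_simps)
        then have "homogeneous (row_mult (rC i) (DC i a) M b) (sC (Suc i) a - (sJ i b - e))"
          using a by (intro homogeneous_row_mult[where s = "sC i"] C.D_homogeneous)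
        then show ?thesis by (simp add: algebra_simps)
      qed
      have "row_mult (rC i) (DC i a) M \<in> J.cycles i"
        using M a by (simp add: P_def)
      then show ?thesis
        using J.homogeneous_cyclesE[OF _ hom] by metis
    qed
    then obtain N where N: "\<And>a. a < rC (Suc i) \<Longrightarrow> N a \<in> free_mod n (rJ (Suc i)) \<and>
        row_mult (rJ (Suc i)) (N a) (DJ i) = row_mult (rC i) (DC i a) M \<and>
        (\<forall>b<rJ (Suc i). homogeneous (N a b) (sC (Suc i) a + e - sJ (Suc i) b))"
      by metis
    have "row_mult (rC (Suc i)) (DC (Suc i) a) N \<in> J.cycles (Suc i)" if a: "a < rC (Suc (Suc i))" for a
    proof -
      have "row_mult (rJ (Suc i)) (row_mult (rC (Suc i)) (DC (Suc i) a) N) (DJ i) =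
          row_mult (rC (Suc i)) (DC (Suc i) a) (\<lambda>c. row_mult (rC i) (DC i c) M)"
        unfolding row_mult_assoc using N by (intro row_mult_cong) auto
      also have "\<dots> = (\<lambda>_. 0)"
        unfolding row_mult_assoc[symmetric] C.row_mult_D_row[OF a] by simp
      moreover have "row_mult (rC (Suc i)) (DC (Suc i) a) N \<in> free_mod n (rJ (Suc i))"
        using N C.D_free_mod[OF a] by (intro row_mult_free_mod) (auto intro: free_mod_carrier)
      ultimately show ?thesis
        by (simp add: J.cycles_def)
    qed
    then have "P (Suc i) N \<and> Q i M N"
      using N unfolding P_def Q_def by blast
    then show "\<exists>N. P (Suc i) N \<and> Q i M N" by (rule exI[of _ N])
  qed
  then obtain A where "\<And>i. P i (A i)" "\<And>i. Q i (A i) (A (Suc i))" by blast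
  then show ?thesis
    by (intro that[of A]) (simp_all add: P_def Q_def)
qed

context aug_resolution
begin

text \<open>A chain endomorphism extending the identity of \<open>R\<close> is homotopic to the identity; by
  minimality the homotopy terms have no constant coefficients.\<close>

lemma lookup_zero_lift_of_id:
  assumes T0: "T 0 0 0 = 1" and T: "\<And>i a. a < r i \<Longrightarrow> T i a \<in> free_mod n (r i)"
    and comm: "\<And>i a. a < r (Suc i) \<Longrightarrow>
      row_mult (r (Suc i)) (T (Suc i) a) (D i) = row_mult (r i) (D i a) (T i)"
    and a: "a < r i"
  shows "Poly_Mapping.lookup (T i a a) 0 = 1"
proof -
  \<comment> \<open>The homotopy \<open>H i\<close> goes from index \<open>i\<close> to
    \<open>Suc i\<close>. The last clause of \<open>P\<close> says that what remains of
    \<open>T\<close> minus the identity after subtracting the known homotopy term is a cycle, hence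
    a boundary; \<open>Q\<close> chooses \<open>H (Suc i)\<close> to hit it.\<close>
  define P where "P i H \<longleftrightarrow> (i = 0 \<longrightarrow> H = (\<lambda>_ _. 0)) \<and> (\<forall>a<r i. H a \<in> free_mod n (r (Suc i))) \<and>
    (\<forall>a<r (Suc i). (\<lambda>b. T (Suc i) a b - basis_vec a b - row_mult (r i) (D i a) H b) \<in> cycles (Suc i))"
    for i and H :: "nat \<Rightarrow> nat \<Rightarrow> 'a mpoly"
  define Q where "Q i H H' \<longleftrightarrow> (\<forall>a<r (Suc i). row_mult (r (Suc (Suc i))) (H' a) (D (Suc i)) =
      (\<lambda>b. T (Suc i) a b - basis_vec a b - row_mult (r i) (D i a) H b))"
    for i and H H' :: "nat \<Rightarrow> nat \<Rightarrow> 'a mpoly"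
  have cyc: "(\<lambda>b. T (Suc i) a b - basis_vec a b - row_mult (r i) (D i a) H b) \<in> cycles (Suc i)"
    if a: "a < r (Suc i)" and H: "\<And>a. a < r i \<Longrightarrow> H a \<in> free_mod n (r (Suc i))"
      and eq: "row_mult (r i) (D i a) (\<lambda>c. row_mult (r (Suc i)) (H c) (D i)) =
        (\<lambda>b. row_mult (r i) (D i a) (T i) b - D i a b)" for i a and H :: "nat \<Rightarrow> nat \<Rightarrow> 'a mpoly"
  proof -
    have "row_mult (r i) (D i a) H \<in> free_mod n (r (Suc i))"
      using H D_free_mod[OF a] by (intro row_mult_free_mod) (auto intro: free_mod_carrier)
    moreover have "row_mult (r (Suc i)) (\<lambda>b. T (Suc i) a b - basis_vec a b - row_mult (r i) (D i a) H b) (D i)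
        = (\<lambda>_. 0)"
      using a by (simp add: row_mult_diff row_mult_basis_vec comm row_mult_assoc eq)
    ultimately show ?thesis
      using T[OF a] a by (simp add: cycles_def free_mod_diff free_mod_basis_vec)
  qed
  have "\<exists>H. \<forall>i. P i (H i) \<and> Q i (H i) (H (Suc i))"
  proof (rule dependent_nat_choice)
    \<comment> \<open>The module at index 0 has rank one, so \<open>T 0 0 0 = 1\<close> makes
      \<open>T 0\<close> the identity and the homotopy can start at zero.\<close>
    have "row_mult (r 0) (D 0 a) (T 0) = D 0 a" if "a < r (Suc 0)" for a
    proof
      show "row_mult (r 0) (D 0 a) (T 0) b = D 0 a b" for b
        using T0 T[of 0 0] D_free_mod[OF that]
        by (cases "b = 0") (simp_all add: rank_0 row_mult_def free_mod_beyond)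
    qed
    then have "P 0 (\<lambda>_ _. 0)"
      unfolding P_def using cyc[where H = "\<lambda>_ _. 0" and i = 0] by (auto simp: free_mod_0)
    then show "\<exists>H. P 0 H" by (rule exI[of _ "\<lambda>_ _. 0"])
  next
    fix H i assume H: "P i H"
    define z where "z a = (\<lambda>b. T (Suc i) a b - basis_vec a b - row_mult (r i) (D i a) H b)" for a
    have "\<exists>w. w \<in> free_mod n (r (Suc (Suc i))) \<and> row_mult (r (Suc (Suc i))) w (D (Suc i)) = z a"
      if "a < r (Suc i)" for a
    proof -
      have "z a \<in> cycles (Suc i)"
        using H that by (simp add: P_def z_def)
      then show ?thesis
        by (rule cyclesE) blast
    qed
    then obtain H' where H': "\<And>a. a < r (Suc i) \<Longrightarrow> H' a \<in> free_mod n (r (Suc (Suc i))) \<and>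
        row_mult (r (Suc (Suc i))) (H' a) (D (Suc i)) = z a"
      by metis
    have "row_mult (r (Suc i)) (D (Suc i) a) (\<lambda>c. row_mult (r (Suc (Suc i))) (H' c) (D (Suc i))) =
        (\<lambda>b. row_mult (r (Suc i)) (D (Suc i) a) (T (Suc i)) b - D (Suc i) a b)"
      if a: "a < r (Suc (Suc i))" for a
    proof -
      have "row_mult (r (Suc i)) (D (Suc i) a) (\<lambda>c. row_mult (r (Suc (Suc i))) (H' c) (D (Suc i))) =
          row_mult (r (Suc i)) (D (Suc i) a)
            (\<lambda>c b. T (Suc i) c b - basis_vec c b - row_mult (r i) (D i c) H b)"
        using H' by (intro row_mult_cong) (auto simp: z_def)
      then show ?thesis
        by (simp add: row_mult_diff_right row_mult_id[OF D_free_mod[OF a]]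
          row_mult_D_row[OF a] flip: row_mult_assoc)
    qed
    then have "P (Suc i) H'"
      unfolding P_def using H' by (auto intro!: cyc)
    moreover have "Q i H H'"
      using H' by (simp add: Q_def z_def)
    ultimately show "\<exists>H'. P (Suc i) H' \<and> Q i H H'"
      by (intro exI[of _ H'] conjI)
  qed
  then obtain H where Q: "\<And>i. Q i (H i) (H (Suc i))" by blast
  show ?thesis
  proof (cases i)
    case 0
    then show ?thesis using a T0 by (simp add: rank_0)
  next
    case (Suc j)
    \<comment> \<open>A diagonal entry of the homotopy identity. Every product on the right has an
      entry of a differential as a factor, so its constant coefficient vanishes.\<close>
    have "T i a a - 1 = row_mult (r (Suc i)) (H (Suc j) a) (D i) a + row_mult (r j) (D j a) (H j) a"
      using Q[of j] a Suc by (simp add: Q_def basis_vec_def fun_eq_iff)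
    moreover have "Poly_Mapping.lookup (row_mult (r (Suc i)) (H (Suc j) a) (D i) a) 0 = 0"
      using a D_minimal[of _ i a] by (simp add: row_mult_def lookup_sum lookup_zero_mult)
    moreover have "Poly_Mapping.lookup (row_mult (r j) (D j a) (H j) a) 0 = 0"
      using a D_minimal[of a j] Suc by (simp add: row_mult_def lookup_sum lookup_zero_mult)
    ultimately have "Poly_Mapping.lookup (T i a a - 1) 0 = 0"
      by (simp add: lookup_add)
    then show ?thesis
      by (simp add: lookup_minus)
  qed
qed

end

text \<open>Lift the identity in both directions. The composite has diagonal constant coefficients
  1, so some entry of the lift \<open>f\<close> in row \<open>a\<close> has a nonzero constant
  coefficient. This entry is homogeneous of degree \<open>s i a - s' i b\<close>, which must then be
  0.\<close>

lemma aug_resolution_shifts_unique: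
  assumes F: "aug_resolution n I r s D" and G: "aug_resolution n I r' s' D'"
    and a: "a < r i"
  shows "\<exists>b<r' i. s' i b = s i a"
proof -
  interpret F: aug_resolution n I r s D by (rule F)
  interpret G: aug_resolution n I r' s' D' by (rule G)
  have one: "p * 1 \<in> I" if "p \<in> I" for p :: "'a mpoly" using that by simp
  obtain f where f: "f 0 = (\<lambda>a b. if b = 0 then 1 else 0)"
    "\<And>i a. a < r i \<Longrightarrow> f i a \<in> free_mod n (r' i)"
    "\<And>i a b. a < r i \<Longrightarrow> b < r' i \<Longrightarrow> homogeneous (f i a b) (s i a + 0 - s' i b)"
    "\<And>i a. a < r (Suc i) \<Longrightarrow>
      row_mult (r' (Suc i)) (f (Suc i) a) (D' i) = row_mult (r i) (D i a) (f i)"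
    by (rule lift_multiplication[OF F G poly_carrier_1 homogeneous_1 one], assumption) (rule that)
  obtain g where g: "g 0 = (\<lambda>a b. if b = 0 then 1 else 0)"
    "\<And>i a. a < r' i \<Longrightarrow> g i a \<in> free_mod n (r i)"
    "\<And>i a b. a < r' i \<Longrightarrow> b < r i \<Longrightarrow> homogeneous (g i a b) (s' i a + 0 - s i b)"
    "\<And>i a. a < r' (Suc i) \<Longrightarrow>
      row_mult (r (Suc i)) (g (Suc i) a) (D i) = row_mult (r' i) (D' i a) (g i)"
    by (rule lift_multiplication[OF G F poly_carrier_1 homogeneous_1 one], assumption) (rule that)
  define T where "T i a = row_mult (r' i) (f i a) (g i)" for i a
  have "Poly_Mapping.lookup (T i a a) 0 = 1"
  proof (rule F.lookup_zero_lift_of_id[where T = T])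
    show "T 0 0 0 = 1"
      by (simp add: T_def f(1) g(1) row_mult_def G.rank_0)
    show "T i a \<in> free_mod n (r i)" if "a < r i" for i a
      unfolding T_def using f(2)[OF that] g(2) by (meson free_mod_carrier row_mult_free_mod)
    show "row_mult (r (Suc i)) (T (Suc i) a) (D i) = row_mult (r i) (D i a) (T i)"
      if a: "a < r (Suc i)" for i a
    proof -
      have "row_mult (r (Suc i)) (T (Suc i) a) (D i) =
          row_mult (r' (Suc i)) (f (Suc i) a) (\<lambda>c. row_mult (r' i) (D' i c) (g i))"
        unfolding T_def row_mult_assoc using g(4) by (intro row_mult_cong) auto
      also have "\<dots> = row_mult (r' i) (row_mult (r i) (D i a) (f i)) (g i)"
        using f(4)[OF a] by (simp flip: row_mult_assoc)
      also have "\<dots> = row_mult (r i) (D i a) (T i)"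
        by (simp add: row_mult_assoc T_def[abs_def])
      finally show ?thesis .
    qed
  qed (rule a)
  then have "(\<Sum>b<r' i. Poly_Mapping.lookup (f i a b) 0 * Poly_Mapping.lookup (g i b a) 0) \<noteq> 0"
    by (simp add: T_def row_mult_def lookup_sum lookup_zero_mult)
  then obtain b where "b \<in> {..<r' i}"
    "Poly_Mapping.lookup (f i a b) 0 * Poly_Mapping.lookup (g i b a) 0 \<noteq> 0"
    by (rule sum.not_neutral_contains_not_neutral)
  then have b: "b < r' i" "Poly_Mapping.lookup (f i a b) 0 \<noteq> 0"
    by simp_all
  then have "s i a - s' i b = 0"
    using lookup_zero_homogeneous[OF f(3)[OF a b(1)]] by auto
  with b(1) show ?thesis by auto
qed

section \<open>Mapping cones\<close>

text \<open>Concatenation encodes direct sums; it is polymorphic so as to serve vectors, matrix rows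
  and shift sequences alike.\<close>

definition join_vec :: "nat \<Rightarrow> (nat \<Rightarrow> 'b) \<Rightarrow> (nat \<Rightarrow> 'b) \<Rightarrow> nat \<Rightarrow> 'b" where
  "join_vec q x y = (\<lambda>b. if b < q then x b else y (b - q))"

lemma sum_lessThan_add: "sum f {..<p + q} = sum f {..<p} + (\<Sum>a<q. f (p + a))"
  for f :: "nat \<Rightarrow> 'b::comm_monoid_add"
  by (induction q) (simp_all add: add.assoc)

lemma row_mult_join_vec:
  "row_mult (p + q) (join_vec p x y) M =
    (\<lambda>b. row_mult p x M b + row_mult q y (\<lambda>a. M (p + a)) b)"
  by (simp add: row_mult_def sum_lessThan_add join_vec_def)

lemma free_mod_join_vec:
  "x \<in> free_mod n p \<Longrightarrow> y \<in> free_mod n q \<Longrightarrow> join_vec p x y \<in> free_mod n (p + q)"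
  by (auto simp: free_mod_def join_vec_def)

lemma free_mod_add_cases:
  assumes "w \<in> free_mod n (p + q)"
  obtains x y where "x \<in> free_mod n p" "y \<in> free_mod n q" "w = join_vec p x y"
proof (rule that)
  show "(\<lambda>a. if a < p then w a else 0) \<in> free_mod n p" "(\<lambda>a. w (p + a)) \<in> free_mod n q"
    using assms by (auto simp: free_mod_def)
qed (auto simp: join_vec_def)

lemma join_vec_eq_iff:
  assumes "x \<in> free_mod n p" "x' \<in> free_mod n p"
  shows "join_vec p x y = join_vec p x' y' \<longleftrightarrow> x = x' \<and> y = y'"
proof
  assume eq: "join_vec p x y = join_vec p x' y'"
  have "x a = x' a" for a
    using fun_cong[OF eq, of a] assms
    by (cases "a < p") (auto simp: join_vec_def free_mod_beyond)
  moreover have "y a = y' a" for a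
    using fun_cong[OF eq, of "p + a"] by (simp add: join_vec_def)
  ultimately show "x = x' \<and> y = y'" by auto
qed auto

lemma join_vec_0: "join_vec p (\<lambda>_. 0) (\<lambda>_. 0) = (\<lambda>_. 0)"
  by (simp add: join_vec_def)

definition shift_set :: "(nat \<Rightarrow> nat) \<Rightarrow> (nat \<Rightarrow> nat \<Rightarrow> int) \<Rightarrow> (nat \<times> int) set" where
  "shift_set r s = {(i, s i a) | i a. a < r i}"

text \<open>The cone of the multiplication \<open>R/C(-deg (B u)) \<rightarrow> R/J\<close> by \<open>B u\<close>, where \<open>C = J : u = J : (B u)\<close>.
  Lifting multiplication by \<open>u\<close> alone and multiplying the lift by \<open>B\<close> keeps the cone minimal.\<close>

lemma mapping_cone:
  fixes J C :: "'a::field mpoly set"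
  assumes "aug_resolution n J rJ sJ DJ" and "aug_resolution n C rC sC DC"
    and B: "B \<in> poly_carrier n" "homogeneous B g" "Poly_Mapping.lookup B 0 = 0"
    and u: "u \<in> poly_carrier n" "homogeneous u e"
    and CJ: "\<And>p. p \<in> C \<Longrightarrow> p * u \<in> J"
    and colon: "\<And>p. p \<in> poly_carrier n \<Longrightarrow> p * (B * u) \<in> J \<Longrightarrow> p \<in> C"
  obtains r s D where "aug_resolution n {p + q * (B * u) | p q. p \<in> J \<and> q \<in> poly_carrier n} r s D"
    and "shift_set r s = shift_set rJ sJ \<union> (\<lambda>(i, j). (Suc i, j + (e + g))) ` shift_set rC sC"
proof -
  interpret J: aug_resolution n J rJ sJ DJ by fact
  interpret C: aug_resolution n C rC sC DC by fact
  obtain A where A0: "A 0 = (\<lambda>a b. if b = 0 then u else 0)"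
    and A_free: "\<And>i a. a < rC i \<Longrightarrow> A i a \<in> free_mod n (rJ i)"
    and A_hom: "\<And>i a b. a < rC i \<Longrightarrow> b < rJ i \<Longrightarrow> homogeneous (A i a b) (sC i a + e - sJ i b)"
    and A_comm: "\<And>i a. a < rC (Suc i) \<Longrightarrow>
      row_mult (rJ (Suc i)) (A (Suc i) a) (DJ i) = row_mult (rC i) (DC i a) (A i)"
    by (rule lift_multiplication[OF C.aug_resolution_axioms J.aug_resolution_axioms u CJ], assumption)
      (rule that)
  \<comment> \<open>The cone at index \<open>Suc i\<close> is the module of R/J at
    \<open>Suc i\<close> plus the module of R/C at \<open>i\<close>; at index 0 the second summand
    is empty, whence the padding with zeros.\<close>
  define rC' where "rC' = case_nat 0 rC"
  define sC' where "sC' = case_nat (\<lambda>_. 0) (\<lambda>i a. sC i a + (e + g))"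
  define DC' where "DC' = case_nat (\<lambda>_ _. 0) DC"
  define r where "r i = rJ i + rC' i" for i
  define s where "s i = join_vec (rJ i) (sJ i) (sC' i)" for i
  \<comment> \<open>The sign on \<open>DC'\<close> makes consecutive maps compose to zero, because
    \<open>A\<close> commutes with the differentials.\<close>
  define D where "D i a = (if a < rJ (Suc i) then join_vec (rJ i) (DJ i a) (\<lambda>_. 0)
    else join_vec (rJ i) (\<lambda>b. B * A i (a - rJ (Suc i)) b) (\<lambda>b. - DC' i (a - rJ (Suc i)) b))" for i a
  let ?J = "{p + q * (B * u) | p q. p \<in> J \<and> q \<in> poly_carrier n}"

  have rC'_simps [simp]: "rC' 0 = 0" "rC' (Suc i) = rC i" for i by (simp_all add: rC'_def)
  have DC'_simps [simp]: "DC' 0 = (\<lambda>_ _. 0)" "DC' (Suc i) = DC i" for i by (simp_all add: DC'_def)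
  have DC'_free: "DC' i a \<in> free_mod n (rC' i)" if "a < rC i" for i a
    using that by (cases i) (simp_all add: free_mod_0 C.D_free_mod)
  have D_free: "D i a \<in> free_mod n (r i)" if "a < r (Suc i)" for i a
    using that B(1)
    by (auto simp: D_def r_def intro!: free_mod_join_vec J.D_free_mod free_mod_0 free_mod_smult
        free_mod_uminus A_free DC'_free)
  have D_hom: "homogeneous (D i a b) (s (Suc i) a - s i b)" if ab: "a < r (Suc i)" "b < r i" for i a b
  proof (cases "a < rJ (Suc i)")
    case True
    then show ?thesis
      by (auto simp: D_def s_def join_vec_def J.D_homogeneous)
  next
    case False
    define c where "c = a - rJ (Suc i)"
    have c: "c < rC i" using ab(1) False by (auto simp: c_def r_def)
    show ?thesis
    proof (cases "b < rJ i")
      case True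
      have "homogeneous (B * A i c b) (g + (sC i c + e - sJ i b))"
        by (intro homogeneous_mult B A_hom c True)
      then show ?thesis
        using True False by (simp add: D_def s_def join_vec_def sC'_def c_def algebra_simps)
    next
      case b: False
      then obtain j where i: "i = Suc j" using ab(2) by (cases i) (auto simp: r_def)
      have "homogeneous (- DC j c (b - rJ i)) (sC (Suc j) c - sC j (b - rJ i))"
        using ab(2) b c i by (intro homogeneous_uminus C.D_homogeneous) (auto simp: r_def)
      then show ?thesis
        using b False i by (simp add: D_def s_def join_vec_def sC'_def c_def)
    qed
  qed
  have D_min: "Poly_Mapping.lookup (D i a b) 0 = 0" if "a < r (Suc i)" "b < r i" for i a b
  proof -
    have "Poly_Mapping.lookup (DC' i c b') 0 = 0" if "c < rC i" "b' < rC' i" for c b'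
      using that by (cases i) (simp_all add: C.D_minimal)
    then show ?thesis
      using that by (auto simp: D_def r_def join_vec_def J.D_minimal lookup_zero_mult B)
  qed
  have D_join: "row_mult (r (Suc i)) (join_vec (rJ (Suc i)) v z) (D i) =
      join_vec (rJ i) (\<lambda>b. row_mult (rJ (Suc i)) v (DJ i) b + B * row_mult (rC i) z (A i) b)
        (\<lambda>b. - row_mult (rC i) z (DC' i) b)" for i v z
  proof
    fix b
    show "row_mult (r (Suc i)) (join_vec (rJ (Suc i)) v z) (D i) b = join_vec (rJ i)
        (\<lambda>b. row_mult (rJ (Suc i)) v (DJ i) b + B * row_mult (rC i) z (A i) b)
        (\<lambda>b. - row_mult (rC i) z (DC' i) b) b"
      unfolding r_def rC'_simps row_mult_join_vec
      by (cases "b < rJ i")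
        (simp_all add: join_vec_def row_mult_def D_def sum_negf sum_distrib_left mult.left_commute)
  qed
  have A_row: "row_mult (rC i) z (A i) \<in> free_mod n (rJ i)" if "z \<in> free_mod n (rC i)" for i z
    using that A_free by (intro row_mult_free_mod) (auto intro: free_mod_carrier)
  have J_row: "(\<lambda>b. row_mult (rJ (Suc i)) v (DJ i) b + B * row_mult (rC i) z (A i) b) \<in> free_mod n (rJ i)"
    if "v \<in> free_mod n (rJ (Suc i))" "z \<in> free_mod n (rC i)" for i v z
    using that by (intro free_mod_add free_mod_smult B A_row J.row_mult_D_free_mod)
  have D_row: "row_mult (r (Suc i)) w (D i) \<in> free_mod n (r i)" if "w \<in> free_mod n (r (Suc i))" for i w
    using that D_free by (intro row_mult_free_mod) (auto intro: free_mod_carrier)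
  have A_lift: "row_mult (rJ (Suc i)) (row_mult (rC (Suc i)) z (A (Suc i))) (DJ i) =
      row_mult (rC i) (row_mult (rC (Suc i)) z (DC i)) (A i)" for i z
    unfolding row_mult_assoc using A_comm by (intro row_mult_cong) auto
  have rJ0: "rJ 0 = Suc 0" and rC0: "rC 0 = Suc 0" using J.rank_0 C.rank_0 by simp_all

  have "aug_resolution n ?J r s D"
  proof
    show "r 0 = 1" "s 0 0 = 0"
      by (simp_all add: r_def s_def join_vec_def J.rank_0 J.shift_0)
    show "(\<lambda>v. row_mult (r (Suc 0)) v (D 0)) ` free_mod n (r (Suc 0)) = {v \<in> free_mod n (r 0). v 0 \<in> ?J}"
      (is "?L = ?R")
    proof (intro equalityI subsetI)
      fix x assume "x \<in> ?L"
      then obtain w where w: "w \<in> free_mod n (r (Suc 0))" "x = row_mult (r (Suc 0)) w (D 0)" by blast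
      from w(1) obtain v z where vz: "v \<in> free_mod n (rJ (Suc 0))" "z \<in> free_mod n (rC 0)"
        "w = join_vec (rJ (Suc 0)) v z"
        unfolding r_def rC'_simps by (rule free_mod_add_cases)
      have "x 0 = row_mult (rJ (Suc 0)) v (DJ 0) 0 + z 0 * (B * u)"
        using w(2) by (simp add: vz(3) D_join) (simp add: join_vec_def rJ0 rC0 row_mult_def A0 mult_ac)
      moreover have "row_mult (rJ (Suc 0)) v (DJ 0) 0 \<in> J"
        using J.row_mult_D_cycle[OF vz(1)] by (simp add: J.cycles_def)
      moreover have "z 0 \<in> poly_carrier n"
        using vz(2) by (rule free_mod_carrier)
      ultimately show "x \<in> ?R"
        using D_row[OF w(1)] w(2) by blast
    next
      fix x assume "x \<in> ?R"
      then obtain p q where x: "x \<in> free_mod n (r 0)" "x 0 = p + q * (B * u)" "p \<in> J" "q \<in> poly_carrier n"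
        by blast
      \<comment> \<open>The locale does not place \<open>J\<close> inside the polynomial ring, so
        membership of \<open>p\<close> there is read off from this difference.\<close>
      have "p = x 0 - q * (B * u)" by (simp add: x(2))
      then have "p \<in> poly_carrier n"
        using free_mod_carrier[OF x(1), of 0] x(4) B(1) u(1) by simp
      then have "(\<lambda>a. if a = 0 then p else 0) \<in> J.cycles 0"
        using x(3) by (simp add: J.cycles_def free_mod_def rJ0)
      then obtain v where v: "v \<in> free_mod n (rJ (Suc 0))"
        "row_mult (rJ (Suc 0)) v (DJ 0) = (\<lambda>a. if a = 0 then p else 0)"
        by (rule J.cyclesE)
      let ?z = "\<lambda>a. if a = 0 then q else 0"
      have z: "?z \<in> free_mod n (rC 0)"
        using x(4) by (simp add: free_mod_def rC0)
      have "row_mult (r (Suc 0)) (join_vec (rJ (Suc 0)) v ?z) (D 0) = x"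
      proof
        fix b
        show "row_mult (r (Suc 0)) (join_vec (rJ (Suc 0)) v ?z) (D 0) b = x b"
          using x(1,2) unfolding D_join v(2)
          by (cases "b = 0")
            (simp_all add: join_vec_def rJ0 rC0 row_mult_def A0 mult_ac free_mod_beyond r_def)
      qed
      moreover have "join_vec (rJ (Suc 0)) v ?z \<in> free_mod n (r (Suc 0))"
        unfolding r_def rC'_simps by (intro free_mod_join_vec v z)
      ultimately show "x \<in> ?L" by blast
    qed
    show "(\<lambda>v. row_mult (r (Suc (Suc i))) v (D (Suc i))) ` free_mod n (r (Suc (Suc i))) =
        {v \<in> free_mod n (r (Suc i)). row_mult (r (Suc i)) v (D i) = (\<lambda>_. 0)}" (is "?L = ?R") for i
    proof (intro equalityI subsetI)
      fix x assume "x \<in> ?L"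
      then obtain w where w: "w \<in> free_mod n (r (Suc (Suc i)))" "x = row_mult (r (Suc (Suc i))) w (D (Suc i))"
        by blast
      from w(1) obtain v z where vz: "v \<in> free_mod n (rJ (Suc (Suc i)))" "z \<in> free_mod n (rC (Suc i))"
        "w = join_vec (rJ (Suc (Suc i))) v z"
        unfolding r_def rC'_simps by (rule free_mod_add_cases)
      have CC: "row_mult (rC i) (row_mult (rC (Suc i)) z (DC i)) (DC' i) = (\<lambda>_. 0)"
        using C.row_mult_D_D vz(2) by (cases i) simp_all
      have "row_mult (r (Suc i)) x (D i) = (\<lambda>_. 0)"
        unfolding w(2) vz(3) D_join DC'_simps
        by (simp add: row_mult_add row_mult_smult row_mult_uminus J.row_mult_D_D vz(1) A_lift CC join_vec_0)
      then show "x \<in> ?R"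
        using D_row[OF w(1)] w(2) by simp
    next
      fix x assume "x \<in> ?R"
      then have x: "x \<in> free_mod n (r (Suc i))" "row_mult (r (Suc i)) x (D i) = (\<lambda>_. 0)" by auto
      from x(1) obtain v z where vz: "v \<in> free_mod n (rJ (Suc i))" "z \<in> free_mod n (rC i)"
        "x = join_vec (rJ (Suc i)) v z"
        unfolding r_def rC'_simps by (rule free_mod_add_cases)
      have "join_vec (rJ i) (\<lambda>b. row_mult (rJ (Suc i)) v (DJ i) b + B * row_mult (rC i) z (A i) b)
        (\<lambda>b. - row_mult (rC i) z (DC' i) b) = join_vec (rJ i) (\<lambda>_. 0) (\<lambda>_. 0)"
        using x(2) unfolding vz(3) D_join join_vec_0 .
      then have eq: "(\<lambda>b. row_mult (rJ (Suc i)) v (DJ i) b + B * row_mult (rC i) z (A i) b) = (\<lambda>_. 0)"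
        and "(\<lambda>b. - row_mult (rC i) z (DC' i) b) = (\<lambda>_. 0)"
        unfolding join_vec_eq_iff[OF J_row[OF vz(1,2)] free_mod_0] by auto
      then have Cz: "row_mult (rC i) z (DC' i) = (\<lambda>_. 0)"
        by (simp add: fun_eq_iff)
      \<comment> \<open>At index 0 the first component of the equation puts
        \<open>z 0 * (B * u)\<close> in \<open>J\<close>, and the colon hypothesis applies. At
        higher indices the second component is the cycle condition.\<close>
      have "z \<in> C.cycles i"
      proof (cases i)
        case 0
        have "row_mult (rJ (Suc 0)) (\<lambda>a. - v a) (DJ 0) 0 \<in> J"
          using J.row_mult_D_cycle[OF free_mod_uminus, of v 0] vz(1) 0 by (simp add: J.cycles_def)
        moreover have "row_mult (rJ (Suc 0)) (\<lambda>a. - v a) (DJ 0) 0 = z 0 * (B * u)"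
        proof -
          have "row_mult (rC 0) z (A 0) 0 = z 0 * u"
            by (simp add: row_mult_def rC0 A0)
          then show ?thesis
            using fun_cong[OF eq, of 0] unfolding row_mult_uminus 0
            by (simp add: add_eq_0_iff mult_ac)
        qed
        ultimately have "z 0 \<in> C"
          using vz(2) by (intro colon) (auto intro: free_mod_carrier)
        then show ?thesis using vz(2) 0 by (simp add: C.cycles_def)
      next
        case (Suc j)
        then show ?thesis using Cz vz(2) by (simp add: C.cycles_def)
      qed
      then obtain y where y: "y \<in> free_mod n (rC (Suc i))" "row_mult (rC (Suc i)) y (DC i) = z"
        by (rule C.cyclesE)
      \<comment> \<open>The image of the pair (0, -y) has second component \<open>z\<close>.
        Subtracting it from \<open>x\<close> leaves this vector in the first component, a cycle of
        the resolution of R/J that can be lifted there.\<close>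
      let ?v = "\<lambda>a. v a + B * row_mult (rC (Suc i)) y (A (Suc i)) a"
      have "?v \<in> free_mod n (rJ (Suc i))"
        using vz(1) y(1) by (intro free_mod_add free_mod_smult B A_row)
      moreover have "row_mult (rJ (Suc i)) ?v (DJ i) = (\<lambda>_. 0)"
        using eq unfolding row_mult_add row_mult_smult A_lift y(2) .
      ultimately have "?v \<in> J.cycles (Suc i)"
        by (simp add: J.cycles_def)
      then obtain w where w: "w \<in> free_mod n (rJ (Suc (Suc i)))"
        "row_mult (rJ (Suc (Suc i))) w (DJ (Suc i)) = ?v"
        by (rule J.cyclesE)
      have "row_mult (r (Suc (Suc i))) (join_vec (rJ (Suc (Suc i))) w (\<lambda>a. - y a)) (D (Suc i)) = x"
        unfolding D_join w(2) vz(3) by (simp add: row_mult_uminus y(2))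
      moreover have "join_vec (rJ (Suc (Suc i))) w (\<lambda>a. - y a) \<in> free_mod n (r (Suc (Suc i)))"
        unfolding r_def rC'_simps by (intro free_mod_join_vec w(1) free_mod_uminus y(1))
      ultimately show "x \<in> ?L" by blast
    qed
  qed (rule D_free D_hom D_min; assumption)+
  moreover have "shift_set r s = shift_set rJ sJ \<union> (\<lambda>(i, j). (Suc i, j + (e + g))) ` shift_set rC sC"
    (is "?L = ?R")
  proof (intro equalityI subsetI)
    fix x assume "x \<in> ?L"
    then obtain i a where x: "x = (i, s i a)" "a < r i" by (auto simp: shift_set_def)
    show "x \<in> ?R"
    proof (cases "a < rJ i")
      case True
      then show ?thesis using x by (auto simp: s_def join_vec_def shift_set_def)
    next
      case False
      then obtain j where i: "i = Suc j" using x(2) by (cases i) (auto simp: r_def)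
      have "(j, sC j (a - rJ i)) \<in> shift_set rC sC"
        using x(2) i False by (auto simp: shift_set_def r_def)
      then have "(Suc j, sC j (a - rJ i) + (e + g)) \<in> (\<lambda>(i, j). (Suc i, j + (e + g))) ` shift_set rC sC"
        by force
      then show ?thesis using x(1) i False by (simp add: s_def join_vec_def sC'_def)
    qed
  next
    fix x assume "x \<in> ?R"
    then consider i a where "x = (i, sJ i a)" "a < rJ i" | i a where "x = (Suc i, sC i a + (e + g))" "a < rC i"
      by (auto simp: shift_set_def)
    then show "x \<in> ?L"
    proof cases
      case 1
      then have "x = (i, s i a)" "a < r i" by (simp_all add: s_def r_def join_vec_def)
      then show ?thesis by (auto simp: shift_set_def)
    next
      case 2
      then have "x = (Suc i, s (Suc i) (rJ (Suc i) + a))" "rJ (Suc i) + a < r (Suc i)"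
        by (simp_all add: s_def r_def join_vec_def sC'_def)
      then show ?thesis unfolding shift_set_def by blast
    qed
  qed
  ultimately show ?thesis by (rule that)
qed

lemma free_mod_0_rank: "free_mod n 0 = {\<lambda>_. 0}"
  by (auto simp: free_mod_def)

text \<open>R alone resolves R/0; every recursion of cones starts here.\<close>

lemma aug_resolution_zero_ideal:
  "aug_resolution n {0} (case_nat 1 (\<lambda>_. 0)) (\<lambda>_ _. 0) (\<lambda>_ _ _. 0)"
proof
  have "v = (\<lambda>_. 0)" if "v \<in> free_mod n 1" "v 0 = 0" for v :: "nat \<Rightarrow> 'a mpoly"
  proof
    show "v a = 0" for a using that by (cases "a = 0") (auto simp: free_mod_def)
  qed
  then have "{v \<in> free_mod n 1. v 0 \<in> {0}} = {\<lambda>_. (0 :: 'a mpoly)}"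
    using free_mod_0[of n 1] by auto
  then show "(\<lambda>v. row_mult (case Suc 0 of 0 \<Rightarrow> 1 | Suc x \<Rightarrow> 0) v (\<lambda>_ _. 0 :: 'a mpoly)) `
      free_mod n (case Suc 0 of 0 \<Rightarrow> 1 | Suc x \<Rightarrow> 0) =
    {v \<in> free_mod n (case 0 of 0 \<Rightarrow> 1 | Suc x \<Rightarrow> 0). v 0 \<in> {0}}"
    by (simp add: free_mod_0_rank)
qed (simp_all add: free_mod_0_rank)

section \<open>Ideals generated by squarefree monomials\<close>

definition sqfree_monom :: "nat set \<Rightarrow> nat \<Rightarrow>\<^sub>0 nat" where
  "sqfree_monom S = (\<Sum>v\<in>S. Poly_Mapping.single v 1)"

lemma lookup_sqfree_monom:
  "finite S \<Longrightarrow> Poly_Mapping.lookup (sqfree_monom S) v = (if v \<in> S then 1 else 0)"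
  by (simp add: sqfree_monom_def lookup_sum lookup_single when_def)

lemma keys_sqfree_monom: "finite S \<Longrightarrow> Poly_Mapping.keys (sqfree_monom S) = S"
  by (auto simp: in_keys_iff lookup_sqfree_monom split: if_splits)

lemma mon_deg_sqfree_monom: "finite S \<Longrightarrow> mon_deg (sqfree_monom S) = card S"
  by (simp add: mon_deg_def keys_sqfree_monom lookup_sqfree_monom)

lemma keys_add_sqfree_monom:
  "finite S \<Longrightarrow> Poly_Mapping.keys (t + sqfree_monom S) = Poly_Mapping.keys t \<union> S"
  by (auto simp: in_keys_iff lookup_add lookup_sqfree_monom split: if_splits)

lemma add_sqfree_monom_cancel:
  "finite S \<Longrightarrow> S \<subseteq> Poly_Mapping.keys t \<Longrightarrow> t - sqfree_monom S + sqfree_monom S = t"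
  by (rule poly_mapping_eqI) (auto simp: lookup_add lookup_minus lookup_sqfree_monom in_keys_iff)

definition sqfree_poly :: "nat set \<Rightarrow> 'a::field mpoly" where
  "sqfree_poly S = Poly_Mapping.single (sqfree_monom S) 1"

lemma sqfree_poly_carrier: "finite S \<Longrightarrow> S \<subseteq> {1..n} \<Longrightarrow> sqfree_poly S \<in> poly_carrier n"
  by (simp add: sqfree_poly_def in_poly_carrier_iff keys_sqfree_monom)

lemma homogeneous_sqfree_poly: "finite S \<Longrightarrow> homogeneous (sqfree_poly S) (int (card S))"
  by (simp add: sqfree_poly_def homogeneous_def mon_deg_sqfree_monom)

lemma sqfree_poly_empty [simp]: "sqfree_poly {} = 1"
  by (simp add: sqfree_poly_def sqfree_monom_def)

lemma sqfree_poly_Un: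
  "finite S \<Longrightarrow> finite T \<Longrightarrow> S \<inter> T = {} \<Longrightarrow> sqfree_poly (S \<union> T) = sqfree_poly S * sqfree_poly T"
  by (simp add: sqfree_poly_def sqfree_monom_def mult_single sum.union_disjoint)

lemma lookup_zero_sqfree_poly:
  assumes "finite S" "S \<noteq> {}"
  shows "Poly_Mapping.lookup (sqfree_poly S) 0 = 0"
  using assms by (intro lookup_zero_homogeneous[OF homogeneous_sqfree_poly]) auto

lemma prod_X: "finite S \<Longrightarrow> (\<Prod>v\<in>S. X v) = sqfree_poly S"
  by (induction S rule: finite_induct)
    (simp_all add: X_def sqfree_poly_def sqfree_monom_def mult_single)

lemma path_gen_eq: "path_gen m l i = sqfree_poly {(i - 1) * (m - l)<..(i - 1) * (m - l) + m}"
proof -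
  let ?c = "(i - 1) * (m - l)"
  have eq: "{?c<..?c + m} = (+) ?c ` {1..m}"
    by (subst image_add_atLeastAtMost) auto
  have "(\<Prod>j=1..m. X (?c + j)) = (\<Prod>v\<in>{?c<..?c + m}. X v :: 'a mpoly)"
    unfolding eq by (subst prod.reindex) simp_all
  then show ?thesis
    by (simp add: path_gen_def prod_X)
qed

lemma lookup_mult_monom:
  "Poly_Mapping.lookup (p * Poly_Mapping.single u 1) (t + u) = Poly_Mapping.lookup p t"
  for p :: "'a::field mpoly"
proof -
  have eq: "(Poly_Mapping.lookup (Poly_Mapping.single u (1::'a)) q when t + u = l + q) =
      ((1 when l = t) when q = u)" for l q
    by (auto simp: lookup_single when_def)
  show ?thesis
    unfolding lookup_mult eq Sum_any_when_equal mult_when by simp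
qed

lemma keys_mult_monom:
  "Poly_Mapping.keys (p * Poly_Mapping.single u 1) = (\<lambda>t. t + u) ` Poly_Mapping.keys p"
  for p :: "'a::field mpoly"
proof
  show "Poly_Mapping.keys (p * Poly_Mapping.single u 1) \<subseteq> (\<lambda>t. t + u) ` Poly_Mapping.keys p"
    using keys_mult[of p "Poly_Mapping.single u (1::'a)"] by auto
qed (auto simp: in_keys_iff lookup_mult_monom)

text \<open>A squarefree monomial divides a monomial exactly when its support is contained in the
  other support. Describing the ideal by supports instead of generators turns membership and colon
  ideals into inclusions of finite sets.\<close>

definition sqfree_ideal :: "nat \<Rightarrow> nat set set \<Rightarrow> 'a::field mpoly set" where
  "sqfree_ideal n \<W> = {p \<in> poly_carrier n. \<forall>t\<in>Poly_Mapping.keys p. \<exists>S\<in>\<W>. S \<subseteq> Poly_Mapping.keys t}"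

lemma sqfree_ideal_empty: "sqfree_ideal n {} = {0}"
  by (auto simp: sqfree_ideal_def poly_mapping_eq_iff fun_eq_iff in_keys_iff)

text \<open>Multiplication by a monomial translates the exponents injectively, so no terms cancel,
  and it enlarges each support by \<open>S\<close>. This is the colon ideal in terms of
  supports.\<close>

lemma mult_sqfree_poly_in_sqfree_ideal_iff:
  assumes "finite S" "S \<subseteq> {1..n}" "p \<in> poly_carrier n"
  shows "p * sqfree_poly S \<in> sqfree_ideal n \<W> \<longleftrightarrow>
    (\<forall>t\<in>Poly_Mapping.keys p. \<exists>W\<in>\<W>. W \<subseteq> Poly_Mapping.keys t \<union> S)"
proof -
  have "p * sqfree_poly S \<in> poly_carrier n"
    using assms by (simp add: sqfree_poly_carrier)
  then show ?thesis
    using assms(1) by (simp add: sqfree_ideal_def sqfree_poly_def keys_mult_monom keys_add_sqfree_monom)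
qed

lemma dvd_sqfree_poly:
  assumes "finite S" "p \<in> poly_carrier n" "\<And>t. t \<in> Poly_Mapping.keys p \<Longrightarrow> S \<subseteq> Poly_Mapping.keys t"
  shows "\<exists>q\<in>poly_carrier n. p = q * sqfree_poly S"
proof
  let ?q = "\<Sum>t\<in>Poly_Mapping.keys p. Poly_Mapping.single (t - sqfree_monom S) (Poly_Mapping.lookup p t)"
  have "?q * sqfree_poly S = (\<Sum>t\<in>Poly_Mapping.keys p. Poly_Mapping.single t (Poly_Mapping.lookup p t))"
    using assms(1,3) by (simp add: sum_distrib_right sqfree_poly_def mult_single add_sqfree_monom_cancel)
  also have "\<dots> = p"
    using poly_part_eq_self[of p UNIV] by (simp add: poly_part_def)
  finally show "p = ?q * sqfree_poly S" ..
  have "Poly_Mapping.keys (t - sqfree_monom S) \<subseteq> Poly_Mapping.keys t" for t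
    by (auto simp: in_keys_iff lookup_minus)
  then show "?q \<in> poly_carrier n"
    using assms(2) by (intro poly_carrier_sum) (auto simp: in_poly_carrier_iff)
qed

text \<open>Terms lying in the old ideal are split off; each remaining term is divisible by the new
  generator. The right-hand side is the form of ideal produced by
  \<open>mapping_cone\<close>.\<close>

lemma sqfree_ideal_insert:
  assumes "finite S" "S \<subseteq> {1..n}"
  shows "sqfree_ideal n (insert S \<W>) =
    {p + q * sqfree_poly S | p q. p \<in> sqfree_ideal n \<W> \<and> q \<in> poly_carrier n}"
proof (intro equalityI subsetI)
  fix f :: "'a mpoly" assume f: "f \<in> sqfree_ideal n (insert S \<W>)"
  define A where "A = {t :: nat \<Rightarrow>\<^sub>0 nat. \<exists>W\<in>\<W>. W \<subseteq> Poly_Mapping.keys t}"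
  have "poly_part A f \<in> sqfree_ideal n \<W>"
    using f by (auto simp: sqfree_ideal_def keys_poly_part A_def)
  moreover have "\<exists>q\<in>poly_carrier n. poly_part (- A) f = q * sqfree_poly S"
    using assms(1) f by (intro dvd_sqfree_poly) (auto simp: sqfree_ideal_def keys_poly_part A_def)
  then obtain q where "q \<in> poly_carrier n" "poly_part (- A) f = q * sqfree_poly S" ..
  moreover have "f = poly_part A f + poly_part (- A) f"
    by (simp add: poly_part_split)
  ultimately have "f = poly_part A f + q * sqfree_poly S \<and> poly_part A f \<in> sqfree_ideal n \<W> \<and>
      q \<in> poly_carrier n" by simp
  then show "f \<in> {p + q * sqfree_poly S | p q. p \<in> sqfree_ideal n \<W> \<and> q \<in> poly_carrier n}"
    by blast
next
  fix f :: "'a mpoly"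
  assume "f \<in> {p + q * sqfree_poly S | p q. p \<in> sqfree_ideal n \<W> \<and> q \<in> poly_carrier n}"
  then obtain p q where f: "f = p + q * sqfree_poly S" "p \<in> sqfree_ideal n \<W>" "q \<in> poly_carrier n"
    by blast
  have "q * sqfree_poly S \<in> sqfree_ideal n (insert S \<W>)"
    using assms f(3) by (simp add: mult_sqfree_poly_in_sqfree_ideal_iff)
  then show "f \<in> sqfree_ideal n (insert S \<W>)"
    using f(1,2) Poly_Mapping.keys_add[of p "q * sqfree_poly S"] by (auto simp: sqfree_ideal_def)
qed

lemma sqfree_ideal_is_ideal: "ideal (sqfree_ideal n \<W> :: 'a::field mpoly set) (mpoly_ring n)"
proof -
  interpret cring "mpoly_ring n :: 'a mpoly ring" by (rule cring_mpoly_ring)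
  have ops: "x \<oplus>\<^bsub>mpoly_ring n\<^esub> y = x + y" "x \<otimes>\<^bsub>mpoly_ring n\<^esub> y = x * y" "\<zero>\<^bsub>mpoly_ring n\<^esub> = 0"
    for x y :: "'a mpoly" by (simp_all add: mpoly_ring_def)
  have minus: "\<ominus>\<^bsub>mpoly_ring n\<^esub> x = - x" if "x \<in> poly_carrier n" for x :: "'a mpoly"
    using that by (intro minus_equality) (simp_all add: ops)
  have mult: "x * a \<in> sqfree_ideal n \<W>" if a: "a \<in> sqfree_ideal n \<W>" and x: "x \<in> poly_carrier n"
    for a x :: "'a mpoly"
  proof -
    have "\<exists>S\<in>\<W>. S \<subseteq> Poly_Mapping.keys t" if t: "t \<in> Poly_Mapping.keys (x * a)" for t
    proof -
      obtain u v where uv: "t = u + v" "v \<in> Poly_Mapping.keys a"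
        using t keys_mult[of x a] by blast
      have "Poly_Mapping.keys v \<subseteq> Poly_Mapping.keys t"
        by (auto simp: uv(1) in_keys_iff lookup_add)
      then show ?thesis
        using a uv(2) unfolding sqfree_ideal_def by blast
    qed
    then show ?thesis
      using a x by (simp add: sqfree_ideal_def)
  qed
  have add: "a + b \<in> sqfree_ideal n \<W>" if "a \<in> sqfree_ideal n \<W>" "b \<in> sqfree_ideal n \<W>"
    for a b :: "'a mpoly"
    using that Poly_Mapping.keys_add[of a b] by (auto simp: sqfree_ideal_def)
  show ?thesis
  proof (rule idealI)
    show "subgroup (sqfree_ideal n \<W>) (add_monoid (mpoly_ring n :: 'a mpoly ring))"
    proof
      show "inv\<^bsub>add_monoid (mpoly_ring n)\<^esub> x \<in> sqfree_ideal n \<W>"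
        if "x \<in> sqfree_ideal n \<W>" for x :: "'a mpoly"
      proof -
        have "x \<in> poly_carrier n" using that by (simp add: sqfree_ideal_def)
        then have "inv\<^bsub>add_monoid (mpoly_ring n)\<^esub> x = - x"
          using minus by (simp add: a_inv_def)
        then show ?thesis using that by (simp add: sqfree_ideal_def)
      qed
    qed (auto simp: ops add, auto simp: sqfree_ideal_def)
    show "a \<otimes>\<^bsub>mpoly_ring n\<^esub> x \<in> sqfree_ideal n \<W>"
      if "a \<in> sqfree_ideal n \<W>" "x \<in> poly_carrier n" for a x :: "'a mpoly"
      using mult[OF that] by (simp add: ops mult.commute)
  qed (simp_all add: ops mult ring_axioms)
qed

text \<open>One inclusion is minimality of the generated ideal. For the other, generators are added
  one at a time, and \<open>sqfree_ideal_insert\<close> writes each element as a combination of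
  them.\<close>

lemma Idl_sqfree_polys:
  assumes "finite \<W>" "\<And>S. S \<in> \<W> \<Longrightarrow> S \<subseteq> {1..n}"
  shows "Idl\<^bsub>mpoly_ring n\<^esub> (sqfree_poly ` \<W>) = (sqfree_ideal n \<W> :: 'a::field mpoly set)"
proof
  interpret cring "mpoly_ring n :: 'a mpoly ring" by (rule cring_mpoly_ring)
  have fin: "finite S" if "S \<in> \<W>" for S
    using assms(2)[OF that] by (rule finite_subset) simp
  show "Idl\<^bsub>mpoly_ring n\<^esub> (sqfree_poly ` \<W>) \<subseteq> (sqfree_ideal n \<W> :: 'a mpoly set)"
  proof (rule genideal_minimal[OF sqfree_ideal_is_ideal], safe)
    fix S assume "S \<in> \<W>"
    then show "sqfree_poly S \<in> (sqfree_ideal n \<W> :: 'a mpoly set)"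
      using mult_sqfree_poly_in_sqfree_ideal_iff[OF fin assms(2), of S 1 \<W>] by auto
  qed
  have gens: "sqfree_poly ` \<W> \<subseteq> (poly_carrier n :: 'a mpoly set)"
    using assms(2) fin sqfree_poly_carrier by blast
  interpret I: ideal "Idl\<^bsub>mpoly_ring n\<^esub> (sqfree_poly ` \<W>)" "mpoly_ring n :: 'a mpoly ring"
    by (rule genideal_ideal[OF gens])
  have "sqfree_ideal n \<V> \<subseteq> (Idl\<^bsub>mpoly_ring n\<^esub> (sqfree_poly ` \<W>) :: 'a mpoly set)" if "\<V> \<subseteq> \<W>" for \<V>
    using finite_subset[OF that assms(1)] that
  proof (induction \<V> rule: finite_induct)
    case empty
    have "\<zero>\<^bsub>mpoly_ring n\<^esub> = (0 :: 'a mpoly)" by (simp add: mpoly_ring_def)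
    then show ?case
      using I.zero_closed by (simp add: sqfree_ideal_empty)
  next
    case (insert S \<V>)
    have "sqfree_poly S \<in> (Idl\<^bsub>mpoly_ring n\<^esub> (sqfree_poly ` \<W>) :: 'a mpoly set)"
      using genideal_self[OF gens] insert.prems by auto
    then have "p + q * sqfree_poly S \<in> (Idl\<^bsub>mpoly_ring n\<^esub> (sqfree_poly ` \<W>) :: 'a mpoly set)"
      if "p \<in> sqfree_ideal n \<V>" "q \<in> poly_carrier n" for p q :: "'a mpoly"
      using I.a_closed[OF _ I.I_l_closed] that insert by (auto simp: mpoly_ring_def)
    then show ?case
      using insert.prems fin assms(2) by (subst sqfree_ideal_insert) auto
  qed
  from this[OF order_refl]
  show "(sqfree_ideal n \<W> :: 'a mpoly set) \<subseteq> Idl\<^bsub>mpoly_ring n\<^esub> (sqfree_poly ` \<W>)" .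
qed

section \<open>Positions of basis elements under mapping cones\<close>

definition cone_shift :: "int \<Rightarrow> (nat \<times> int) set \<Rightarrow> (nat \<times> int) set" where
  "cone_shift c \<Sigma> = (\<lambda>(i, j). (Suc i, j + c)) ` \<Sigma>"

lemma cone_shiftI: "(i, j) \<in> \<Sigma> \<Longrightarrow> (Suc i, j + c) \<in> cone_shift c \<Sigma>"
  unfolding cone_shift_def by (rule image_eqI[of _ _ "(i, j)"]) simp_all

lemma cone_shift_Un: "cone_shift c (\<Sigma> \<union> \<Gamma>) = cone_shift c \<Sigma> \<union> cone_shift c \<Gamma>"
  by (simp add: cone_shift_def image_Un)

definition has_shifts :: "nat \<Rightarrow> 'a::field mpoly set \<Rightarrow> (nat \<times> int) set \<Rightarrow> bool" where
  "has_shifts n J \<Sigma> \<longleftrightarrow> (\<exists>r s D. aug_resolution n J r s D \<and> shift_set r s = \<Sigma>)"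

lemma has_shifts_zero: "has_shifts n {0} {(0, 0)}"
  unfolding has_shifts_def
  by (intro exI conjI, rule aug_resolution_zero_ideal) (auto simp: shift_set_def gr0_conv_Suc split: nat.splits)

text \<open>\<open>mapping_cone\<close> with \<open>T\<close> as the block \<open>B\<close> and
  \<open>S\<close> as the rest of the generator; \<open>K\<close> stands for the support of a
  monomial. The assumption \<open>colon\<close> places the colon ideal by
  \<open>S \<union> T\<close> inside that of \<open>\<C>\<close>, and \<open>colon'\<close> places
  the latter inside the colon ideal by \<open>S\<close>. As the colon by \<open>S\<close> lies in
  that by \<open>S \<union> T\<close>, all three agree.\<close>

lemma has_shifts_insert:
  assumes J: "has_shifts n (sqfree_ideal n \<W> :: 'a::field mpoly set) \<Sigma>"
    and C: "has_shifts n (sqfree_ideal n \<C> :: 'a mpoly set) \<Gamma>"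
    and S: "S \<union> T \<subseteq> {1..n}" "S \<inter> T = {}" "T \<noteq> {}"
    and colon: "\<And>W K. W \<in> \<W> \<Longrightarrow> W \<subseteq> K \<union> (S \<union> T) \<Longrightarrow> \<exists>V\<in>\<C>. V \<subseteq> K"
    and colon': "\<And>V K. V \<in> \<C> \<Longrightarrow> V \<subseteq> K \<Longrightarrow> \<exists>W\<in>\<W>. W \<subseteq> K \<union> S"
  shows "has_shifts n (sqfree_ideal n (insert (S \<union> T) \<W>) :: 'a mpoly set)
    (\<Sigma> \<union> cone_shift (int (card (S \<union> T))) \<Gamma>)"
proof -
  have fin: "finite S" "finite T"
    using S(1) by (auto intro: finite_subset)
  from J C obtain rJ sJ DJ rC sC DC where
    J: "aug_resolution n (sqfree_ideal n \<W> :: 'a mpoly set) rJ sJ DJ" "shift_set rJ sJ = \<Sigma>" and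
    C: "aug_resolution n (sqfree_ideal n \<C> :: 'a mpoly set) rC sC DC" "shift_set rC sC = \<Gamma>"
    unfolding has_shifts_def by blast
  have eq: "sqfree_poly (S \<union> T) = sqfree_poly T * (sqfree_poly S :: 'a mpoly)"
    using fin S(2) sqfree_poly_Un[of T S] by (simp add: Un_commute Int_commute)
  have card: "int (card (S \<union> T)) = int (card S) + int (card T)"
    using fin S(2) by (simp add: card_Un_disjoint)
  obtain r s D where "aug_resolution n {p + q * (sqfree_poly T * sqfree_poly S) | p q.
      p \<in> (sqfree_ideal n \<W> :: 'a mpoly set) \<and> q \<in> poly_carrier n} r s D"
    "shift_set r s = shift_set rJ sJ \<union>
      (\<lambda>(i, j). (Suc i, j + (int (card S) + int (card T)))) ` shift_set rC sC"
  proof (rule mapping_cone[OF J(1) C(1), where B = "sqfree_poly T" and u = "sqfree_poly S"])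
    show "p * sqfree_poly S \<in> sqfree_ideal n \<W>" if "p \<in> sqfree_ideal n \<C>" for p :: "'a mpoly"
      using that S(1) fin colon' by (subst mult_sqfree_poly_in_sqfree_ideal_iff)
        (auto simp: sqfree_ideal_def)
    show "p \<in> sqfree_ideal n \<C>"
      if "p \<in> poly_carrier n" "p * (sqfree_poly T * sqfree_poly S) \<in> sqfree_ideal n \<W>" for p :: "'a mpoly"
    proof -
      have "\<forall>t\<in>Poly_Mapping.keys p. \<exists>W\<in>\<W>. W \<subseteq> Poly_Mapping.keys t \<union> (S \<union> T)"
        using that S(1) fin mult_sqfree_poly_in_sqfree_ideal_iff[of "S \<union> T" n p \<W>] by (simp add: eq)
      then show ?thesis
        using that(1) colon unfolding sqfree_ideal_def by blast
    qed
    show "sqfree_poly T \<in> poly_carrier n" "sqfree_poly S \<in> poly_carrier n"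
      using S(1) by (auto intro!: sqfree_poly_carrier fin simp del: One_nat_def)
  qed (use fin S(3) in \<open>auto intro: homogeneous_sqfree_poly simp: lookup_zero_sqfree_poly\<close>)
  then show ?thesis
    using fin S(1) J(2) C(2) unfolding has_shifts_def cone_shift_def card
    by (subst sqfree_ideal_insert) (auto simp: eq)
qed

section \<open>Betti numbers from augmented resolutions\<close>

text \<open>R is put in front of a resolution of \<open>I\<close>. The new differential is minimal
  because the generators, as elements of \<open>I\<close>, have no constant term.\<close>

lemma aug_resolution_of_minimal:
  assumes F: "minimal_graded_free_resolution n I F" and I: "\<And>p. p \<in> I \<Longrightarrow> Poly_Mapping.lookup p 0 = 0"
  shows "aug_resolution n I (case_nat 1 (frank F)) (case_nat (\<lambda>_. 0) (gshift F))
    (case_nat (\<lambda>a b. if b = 0 then aug F a else 0) (bdry F))"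
proof -
  let ?D0 = "\<lambda>a b. if b = 0 then aug F a else 0"
  from F have aug: "\<forall>a<frank F 0. aug F a \<in> poly_carrier n \<and> homogeneous (aug F a) (gshift F 0 a)"
    and bdry: "\<forall>i. \<forall>a<frank F (Suc i). bdry F i a \<in> free_mod n (frank F i) \<and>
        (\<forall>b<frank F i. homogeneous (bdry F i a b) (gshift F (Suc i) a - gshift F i b))"
    and img: "aug_map F ` free_mod n (frank F 0) = I"
    and ex0: "{v \<in> free_mod n (frank F 0). aug_map F v = 0} =
       bdry_map F 0 ` free_mod n (frank F (Suc 0))"
    and ex: "\<forall>i. {v \<in> free_mod n (frank F (Suc i)). bdry_map F i v = (\<lambda>_. 0)} =
       bdry_map F (Suc i) ` free_mod n (frank F (Suc (Suc i)))"
    and min: "\<forall>i. \<forall>a<frank F (Suc i). \<forall>b<frank F i. Poly_Mapping.lookup (bdry F i a b) 0 = 0"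
    unfolding minimal_graded_free_resolution_def graded_free_resolution_def
    by - (elim conjE, assumption)+
  have bdry_map: "row_mult (frank F (Suc i)) v (bdry F i) = bdry_map F i v" for i v
    by (simp add: row_mult_def bdry_map_def)
  have aug_map: "row_mult (frank F 0) v ?D0 = (\<lambda>b. if b = 0 then aug_map F v else 0)" for v
    by (auto simp: row_mult_def aug_map_def)
  have aug_I: "aug F a \<in> I" if "a < frank F 0" for a
  proof -
    have "aug_map F (basis_vec a) = aug F a"
      using fun_cong[OF row_mult_basis_vec[OF that, of ?D0], of 0] unfolding aug_map by simp
    then show ?thesis
      using free_mod_basis_vec[OF that, of n] unfolding img[symmetric]
      by (intro image_eqI[of _ _ "basis_vec a"]) simp_all
  qed
  show ?thesis
  proof
    fix a i assume a: "a < (case Suc i of 0 \<Rightarrow> 1 | Suc i \<Rightarrow> frank F i)"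
    show "(case i of 0 \<Rightarrow> ?D0 | Suc i \<Rightarrow> bdry F i) a \<in> free_mod n (case i of 0 \<Rightarrow> 1 | Suc i \<Rightarrow> frank F i)"
      using a aug bdry by (cases i) (auto simp: free_mod_def)
    fix b assume b: "b < (case i of 0 \<Rightarrow> 1 | Suc i \<Rightarrow> frank F i)"
    show "homogeneous ((case i of 0 \<Rightarrow> ?D0 | Suc i \<Rightarrow> bdry F i) a b)
      ((case Suc i of 0 \<Rightarrow> \<lambda>_. 0 | Suc i \<Rightarrow> gshift F i) a - (case i of 0 \<Rightarrow> \<lambda>_. 0 | Suc i \<Rightarrow> gshift F i) b)"
      using a b aug bdry by (cases i) simp_all
    show "Poly_Mapping.lookup ((case i of 0 \<Rightarrow> ?D0 | Suc i \<Rightarrow> bdry F i) a b) 0 = 0"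
      using a b aug_I I min by (cases i) simp_all
  next
    have "(\<lambda>v. row_mult (frank F 0) v ?D0) ` free_mod n (frank F 0) = {v \<in> free_mod n 1. v 0 \<in> I}"
    proof (intro equalityI subsetI)
      fix x assume "x \<in> (\<lambda>v. row_mult (frank F 0) v ?D0) ` free_mod n (frank F 0)"
      then obtain v where v: "v \<in> free_mod n (frank F 0)" "x = (\<lambda>b. if b = 0 then aug_map F v else 0)"
        unfolding aug_map by blast
      have "aug_map F v \<in> poly_carrier n"
        unfolding aug_map_def using free_mod_carrier[OF v(1)] aug by (intro poly_carrier_sum) auto
      moreover have "aug_map F v \<in> I" using v(1) img by blast
      ultimately show "x \<in> {v \<in> free_mod n 1. v 0 \<in> I}"
        using v(2) by (simp add: free_mod_def)
    next
      fix x assume x: "x \<in> {v \<in> free_mod n 1. v 0 \<in> I}"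
      then obtain v where v: "v \<in> free_mod n (frank F 0)" "x 0 = aug_map F v"
        using img by auto
      have "x = row_mult (frank F 0) v ?D0"
        unfolding aug_map using x v(2) by (auto simp: free_mod_def)
      with v(1) show "x \<in> (\<lambda>v. row_mult (frank F 0) v ?D0) ` free_mod n (frank F 0)"
        by blast
    qed
    then show "(\<lambda>v. row_mult (case Suc 0 of 0 \<Rightarrow> 1 | Suc i \<Rightarrow> frank F i) v
          (case 0 of 0 \<Rightarrow> ?D0 | Suc i \<Rightarrow> bdry F i)) `
        free_mod n (case Suc 0 of 0 \<Rightarrow> 1 | Suc i \<Rightarrow> frank F i) =
      {v \<in> free_mod n (case 0 of 0 \<Rightarrow> 1 | Suc i \<Rightarrow> frank F i). v 0 \<in> I}"
      by simp
  next
    fix i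
    show "(\<lambda>v. row_mult (case Suc (Suc i) of 0 \<Rightarrow> 1 | Suc i \<Rightarrow> frank F i) v
          (case Suc i of 0 \<Rightarrow> ?D0 | Suc i \<Rightarrow> bdry F i)) `
        free_mod n (case Suc (Suc i) of 0 \<Rightarrow> 1 | Suc i \<Rightarrow> frank F i) =
      {v \<in> free_mod n (case Suc i of 0 \<Rightarrow> 1 | Suc i \<Rightarrow> frank F i).
        row_mult (case Suc i of 0 \<Rightarrow> 1 | Suc i \<Rightarrow> frank F i) v
          (case i of 0 \<Rightarrow> ?D0 | Suc i \<Rightarrow> bdry F i) = (\<lambda>_. 0)}"
    proof (cases i)
      case 0
      have "aug_map F v = 0 \<longleftrightarrow> row_mult (frank F 0) v ?D0 = (\<lambda>_. 0)" for v
        unfolding aug_map by (auto simp: fun_eq_iff)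
      then show ?thesis
        using ex0 0 by (simp add: bdry_map)
    next
      case (Suc j)
      then show ?thesis
        using spec[OF ex, of j] Suc by (simp add: bdry_map)
    qed
  qed simp_all
qed

text \<open>Forgetting R at index 0 and reading \<open>D 0\<close> as the augmentation leaves a
  resolution of \<open>J\<close>. It witnesses that the choice made in \<open>betti\<close> has
  something to choose from.\<close>

lemma (in aug_resolution) minimal_resolution:
  assumes J: "J \<subseteq> poly_carrier n"
  shows "minimal_graded_free_resolution n J
    \<lparr>frank = \<lambda>i. r (Suc i), gshift = \<lambda>i. s (Suc i), aug = \<lambda>a. D 0 a 0, bdry = \<lambda>i. D (Suc i)\<rparr>"
    (is "minimal_graded_free_resolution n J ?F")
proof -
  have bdry_map: "bdry_map ?F i v = row_mult (r (Suc (Suc i))) v (D (Suc i))" for i v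
    by (simp add: row_mult_def bdry_map_def)
  have aug_map: "aug_map ?F v = row_mult (r (Suc 0)) v (D 0) 0" for v
    by (simp add: row_mult_def aug_map_def)
  have aug_map_0: "row_mult (r (Suc 0)) v (D 0) = (\<lambda>_. 0) \<longleftrightarrow> aug_map ?F v = 0"
    if v: "v \<in> free_mod n (r (Suc 0))" for v
  proof -
    have "row_mult (r (Suc 0)) v (D 0) b = 0" if "b \<noteq> 0" for b
      using row_mult_D_free_mod[OF v] that by (simp add: free_mod_beyond rank_0)
    then show ?thesis
      unfolding aug_map by (metis ext)
  qed
  have img: "aug_map ?F ` free_mod n (r (Suc 0)) = J"
  proof (intro equalityI subsetI)
    fix p assume "p \<in> aug_map ?F ` free_mod n (r (Suc 0))"
    then show "p \<in> J"
      using row_mult_D_cycle[of _ 0] by (auto simp: aug_map cycles_def)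
  next
    fix p assume "p \<in> J"
    then have "(\<lambda>a. if a = 0 then p else 0) \<in> cycles 0"
      using J by (auto simp: cycles_def free_mod_def rank_0)
    then obtain v where "v \<in> free_mod n (r (Suc 0))" "row_mult (r (Suc 0)) v (D 0) = (\<lambda>a. if a = 0 then p else 0)"
      by (rule cyclesE)
    then show "p \<in> aug_map ?F ` free_mod n (r (Suc 0))"
      by (intro image_eqI[of _ _ v]) (simp_all add: aug_map)
  qed
  have "graded_free_resolution n J ?F"
    unfolding graded_free_resolution_def
  proof (intro conjI allI impI)
    show "aug_map ?F ` free_mod n (frank ?F 0) = J"
      using img by simp
    show "{v \<in> free_mod n (frank ?F 0). aug_map ?F v = 0} = bdry_map ?F 0 ` free_mod n (frank ?F (Suc 0))"
      using exact_Suc[of 0] aug_map_0 by (auto simp: bdry_map)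
    show "{v \<in> free_mod n (frank ?F (Suc i)). bdry_map ?F i v = (\<lambda>_. 0)} =
        bdry_map ?F (Suc i) ` free_mod n (frank ?F (Suc (Suc i)))" for i
      using exact_Suc[of "Suc i"] by (simp add: bdry_map)
  next
    fix a assume "a < frank ?F 0"
    then show "aug ?F a \<in> poly_carrier n" "homogeneous (aug ?F a) (gshift ?F 0 a)"
      using free_mod_carrier[OF D_free_mod] D_homogeneous[of a 0 0] by (simp_all add: rank_0 shift_0)
  next
    fix i a assume "a < frank ?F (Suc i)"
    then show "bdry ?F i a \<in> free_mod n (frank ?F i)"
      using D_free_mod by simp
  next
    fix i a b assume "a < frank ?F (Suc i)" "b < frank ?F i"
    then show "homogeneous (bdry ?F i a b) (gshift ?F (Suc i) a - gshift ?F i b)"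
      using D_homogeneous by simp
  qed
  then show ?thesis
    by (simp add: minimal_graded_free_resolution_def D_minimal)
qed

text \<open>Nothing is known of the resolution chosen in \<open>betti\<close> beyond its minimality,
  so its shifts are compared with the constructed ones in both directions. The \<open>Suc\<close>
  accounts for R at index 0.\<close>

lemma betti_neq_0_iff:
  assumes "has_shifts n I \<Sigma>" "I \<subseteq> poly_carrier n" "\<And>p. p \<in> I \<Longrightarrow> Poly_Mapping.lookup p 0 = 0"
  shows "betti n I i j \<noteq> 0 \<longleftrightarrow> (Suc i, j) \<in> \<Sigma>"
proof -
  from assms(1) obtain r s D where R: "aug_resolution n I r s D" and \<Sigma>: "\<Sigma> = shift_set r s"
    unfolding has_shifts_def by auto
  define F where "F = (SOME F. minimal_graded_free_resolution n I F)"
  have "minimal_graded_free_resolution n I F"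
    unfolding F_def using aug_resolution.minimal_resolution[OF R assms(2)] by (rule someI)
  then have R': "aug_resolution n I (case_nat 1 (frank F)) (case_nat (\<lambda>_. 0) (gshift F))
      (case_nat (\<lambda>a b. if b = 0 then aug F a else 0) (bdry F))"
    using assms(3) by (rule aug_resolution_of_minimal)
  have "betti n I i j = card {a. a < frank F i \<and> gshift F i a = j}"
    by (simp add: betti_def F_def Let_def)
  then have "betti n I i j \<noteq> 0 \<longleftrightarrow> (\<exists>a<frank F i. gshift F i a = j)"
    by (auto simp: card_gt_0_iff)
  also have "\<dots> \<longleftrightarrow> (\<exists>b<r (Suc i). s (Suc i) b = j)"
    using aug_resolution_shifts_unique[OF R R', of _ "Suc i"]
      aug_resolution_shifts_unique[OF R' R, of _ "Suc i"] by auto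
  also have "\<dots> \<longleftrightarrow> (Suc i, j) \<in> \<Sigma>"
    by (auto simp: \<Sigma> shift_set_def)
  finally show ?thesis .
qed

section \<open>Path ideals\<close>

text \<open>The support of u_{i+1}: with zero-based \<open>i\<close>, the first \<open>k\<close>
  generators are the windows below \<open>k\<close>.\<close>

definition window :: "nat \<Rightarrow> nat \<Rightarrow> nat \<Rightarrow> nat set" where
  "window q c i = {i * c<..(i + q) * c}"

text \<open>The inner set holds the positions for the colon ideal of window \<open>k\<close>. For
  \<open>k = 0\<close> that ideal is zero. For \<open>0 < k < q\<close> the truncated
  \<open>k - q\<close> is 0, leaving the ideal of the preceding block alone, with positions (0, 0)
  and (1, c).\<close>

fun path_shifts :: "nat \<Rightarrow> nat \<Rightarrow> nat \<Rightarrow> (nat \<times> int) set" where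
  "path_shifts q c 0 = {(0, 0)}"
| "path_shifts q c (Suc k) = path_shifts q c k \<union> cone_shift (int (q * c))
    (if k = 0 then {(0, 0)}
     else path_shifts q c (k - q) \<union> cone_shift (int c) (path_shifts q c (k - q)))"

lemma window_subset: "(i + q) * c \<le> n \<Longrightarrow> window q c i \<subseteq> {1..n}"
  by (auto simp: window_def)

lemma window_disjoint:
  assumes "i + q \<le> a"
  shows "window q c i \<inter> {a * c<..b} = {}"
proof -
  have "(i + q) * c \<le> a * c" using assms by (rule mult_le_mono1)
  then show ?thesis by (auto simp: window_def)
qed

text \<open>With \<open>u\<close> the product of window \<open>k\<close> and \<open>I\<close> the ideal of the previous windows, \<open>I : u\<close> is generated
  by the block \<open>{(k - 1) c<..k c}\<close> and the first \<open>k - q\<close> windows, and removing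
  the last block of \<open>u\<close> does not change it.\<close>

lemma has_shifts_windows:
  assumes "q \<ge> 1" "c \<ge> 1"
  shows "(k + q) * c \<le> n + c \<Longrightarrow>
    has_shifts n (sqfree_ideal n (window q c ` {..<k}) :: 'a::field mpoly set) (path_shifts q c k)"
proof (induction k rule: less_induct)
  case (less k)
  show ?case
  proof (cases k)
    case 0
    then show ?thesis by (simp add: sqfree_ideal_empty has_shifts_zero)
  next
    case (Suc j)
    define S where "S = {j * c<..(j + q - 1) * c}"
    define T where "T = {(j + q - 1) * c<..(j + q) * c}"
    define \<C> where "\<C> = (if j = 0 then {} else insert {(j - 1) * c<..j * c} (window q c ` {..<j - q}))"
    define \<Gamma> where "\<Gamma> = (if j = 0 then {(0, 0)}
      else path_shifts q c (j - q) \<union> cone_shift (int c) (path_shifts q c (j - q)))"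
    \<comment> \<open>The assumption says additively that the last window, number
      \<open>k - 1\<close>, ends within the \<open>n\<close> variables.\<close>
    have jq: "(j + q) * c \<le> n"
      using less.prems by (simp add: Suc)
    have le: "j * c \<le> (j + q - 1) * c" "(j + q - 1) * c < (j + q) * c"
      using assms by (auto intro: mult_le_mono1)
    have ST: "S \<union> T = window q c j"
      unfolding S_def T_def window_def using le by (intro ivl_disj_un_two) simp_all
    have IH: "has_shifts n (sqfree_ideal n (window q c ` {..<i}) :: 'a mpoly set) (path_shifts q c i)"
      if "i \<le> j" for i
    proof (rule less.IH)
      have "(i + q) * c \<le> (j + q) * c" using that by (intro mult_le_mono1) simp
      then show "(i + q) * c \<le> n + c" using jq by linarith
    qed (use that Suc in simp)
    have \<C>: "has_shifts n (sqfree_ideal n \<C> :: 'a mpoly set) \<Gamma>"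
    proof (cases "j = 0")
      case True
      then show ?thesis by (simp add: \<C>_def \<Gamma>_def sqfree_ideal_empty has_shifts_zero)
    next
      case False
      then obtain h where h: "j = Suc h" by (cases j) auto
      let ?b = "{(j - 1) * c<..j * c}"
      have "j * c \<le> n"
        using jq mult_le_mono1[of j "j + q" c] by linarith
      then have sub: "{} \<union> ?b \<subseteq> {1..n}" by auto
      have ne: "?b \<noteq> {}" using assms(2) by (simp add: h)
      have card: "card ({} \<union> ?b) = c" by (simp add: h)
      \<comment> \<open>Here the whole block plays the role of \<open>T\<close>. It is disjoint from
        the first \<open>j - q\<close> windows, so the colon ideal by it is again the ideal of these
        windows.\<close>
      have "has_shifts n (sqfree_ideal n (insert ({} \<union> ?b) (window q c ` {..<j - q})) :: 'a mpoly set)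
          (path_shifts q c (j - q) \<union> cone_shift (int (card ({} \<union> ?b))) (path_shifts q c (j - q)))"
      proof (rule has_shifts_insert[OF IH IH sub _ ne])
        fix W K assume W: "W \<in> window q c ` {..<j - q}" "W \<subseteq> K \<union> ({} \<union> ?b)"
        then obtain i where i: "W = window q c i" "i < j - q" by auto
        then have "W \<inter> ?b = {}" using window_disjoint[of i q "j - 1"] by simp
        then show "\<exists>V\<in>window q c ` {..<j - q}. V \<subseteq> K"
          using W by (intro bexI[of _ W]) auto
      qed auto
      then show ?thesis
        using False unfolding card by (simp add: \<C>_def \<Gamma>_def)
    qed
    have "has_shifts n (sqfree_ideal n (insert (S \<union> T) (window q c ` {..<j})) :: 'a mpoly set)
        (path_shifts q c j \<union> cone_shift (int (card (S \<union> T))) \<Gamma>)"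
    proof (rule has_shifts_insert[OF IH \<C>])
      show "S \<union> T \<subseteq> {1..n}" unfolding ST by (rule window_subset[OF jq])
      show "S \<inter> T = {}" by (auto simp: S_def T_def)
      show "T \<noteq> {}" using le(2) by (simp add: T_def)
    next
      fix W K assume W: "W \<in> window q c ` {..<j}" "W \<subseteq> K \<union> (S \<union> T)"
      then obtain i where i: "W = window q c i" "i < j" by auto
      show "\<exists>V\<in>\<C>. V \<subseteq> K"
      proof (cases "i < j - q")
        case True
        then have "W \<inter> (S \<union> T) = {}"
          unfolding ST i(1) window_def[of q c j] by (intro window_disjoint) simp
        then show ?thesis
          using True W i by (intro bexI[of _ W]) (auto simp: \<C>_def)
      next
        case False
        \<comment> \<open>A window with \<open>j - q \<le> i < j\<close> starts before the block
          preceding window \<open>j\<close> and reaches at least its end, so it contains this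
          block.\<close>
        have "i * c \<le> (j - 1) * c" "j * c \<le> (i + q) * c"
          using i(2) False by (auto intro: mult_le_mono1)
        then have "{(j - 1) * c<..j * c} \<subseteq> W"
          unfolding i(1) window_def by (meson greaterThanAtMost_iff le_less_trans order_trans subsetI)
        moreover have "{(j - 1) * c<..j * c} \<inter> (S \<union> T) = {}"
          unfolding ST by (auto simp: window_def)
        ultimately have "{(j - 1) * c<..j * c} \<subseteq> K" using W(2) by blast
        then show ?thesis using i(2) by (simp add: \<C>_def)
      qed
    next
      fix V K assume V: "V \<in> \<C>" "V \<subseteq> K"
      then have j: "j \<noteq> 0" by (auto simp: \<C>_def split: if_splits)
      show "\<exists>W\<in>window q c ` {..<j}. W \<subseteq> K \<union> S"
      proof (cases "V \<in> window q c ` {..<j - q}")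
        case True
        then show ?thesis using V(2) by (intro bexI[of _ V]) auto
      next
        case False
        then have "V = {(j - 1) * c<..j * c}" using V(1) j by (auto simp: \<C>_def)
        \<comment> \<open>The previous window ends one block earlier than window \<open>j\<close>,
          so it needs nothing of \<open>T\<close>; this is why \<open>S\<close> already suffices for
          the colon ideal.\<close>
        moreover have "window q c (j - 1) \<subseteq> {(j - 1) * c<..j * c} \<union> S"
          using j by (auto simp: window_def S_def)
        ultimately have "window q c (j - 1) \<subseteq> K \<union> S" using V(2) by blast
        then show ?thesis using j by auto
      qed
    qed simp
    moreover have "card (S \<union> T) = q * c"
      unfolding ST by (simp add: window_def add_mult_distrib)
    ultimately show ?thesis
      unfolding ST by (simp add: Suc \<Gamma>_def lessThan_Suc)
  qed
qed

section \<open>The extremal position of the recursion\<close>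

text \<open>For \<open>k \<ge> 1\<close> this is the projective dimension of R/I, and
  \<open>top_excess\<close> is its regularity. The quotient of \<open>k + q - 1\<close> by
  \<open>q + 1\<close> counts double cone steps, each worth 2 in index and
  \<open>(q + 1) * c - 2\<close> in excess; remainder \<open>q\<close> means one further cone on a
  single generator, worth 1 and \<open>q * c - 1\<close>.\<close>

definition top_index :: "nat \<Rightarrow> nat \<Rightarrow> nat" where
  "top_index q k = 2 * ((k + q - 1) div (q + 1)) + (if (k + q - 1) mod (q + 1) = q then 1 else 0)"

definition top_excess :: "nat \<Rightarrow> nat \<Rightarrow> nat \<Rightarrow> int" where
  "top_excess q c k = int ((k + q - 1) div (q + 1)) * (int ((q + 1) * c) - 2)
     + (if (k + q - 1) mod (q + 1) = q then int (q * c) - 1 else 0)"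

context
  fixes q c :: nat
  assumes q: "q \<ge> 1" and c: "c \<ge> 1"
begin

lemma top_0: "top_index q 0 = 0" "top_excess q c 0 = 0"
  using q by (cases q; simp add: top_index_def top_excess_def)+

lemma top_1: "top_index q (Suc 0) = 1" "top_excess q c (Suc 0) = int (q * c) - 1"
  by (simp_all add: top_index_def top_excess_def)

text \<open>For \<open>k \<ge> q\<close> the two numerators differ by one period
  \<open>q + 1\<close>. For \<open>k < q\<close> the subtraction truncates and the remainders become
  \<open>k - 1\<close> and \<open>q - 1\<close>; neither equals \<open>q\<close>, which is all that
  the formulas see.\<close>

lemma top_step:
  assumes "k \<ge> 1"
  shows "top_index q (Suc k) = top_index q (k - q) + 2"
    and "top_excess q c (Suc k) = top_excess q c (k - q) + int ((q + 1) * c) - 2"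
proof -
  have "(k + q) div (q + 1) = (k - q + q - 1) div (q + 1) + 1 \<and>
    ((k + q) mod (q + 1) = q \<longleftrightarrow> (k - q + q - 1) mod (q + 1) = q)"
  proof (cases "k \<ge> q")
    case True
    then have "k + q = (k - q + q - 1) + (q + 1)" using q by simp
    then show ?thesis by (metis div_add_self2 mod_add_self2 add_is_0 one_neq_zero)
  next
    case False
    then have "(k + q) div (q + 1) = 1" "(k + q) mod (q + 1) = k - 1"
      using assms by (auto simp: div_if mod_if)
    moreover have "(k - q + q - 1) div (q + 1) = 0" "(k - q + q - 1) mod (q + 1) = q - 1"
      using False by simp_all
    moreover have "k - 1 \<noteq> q" "q - 1 \<noteq> q" using False q by auto
    ultimately show ?thesis by (simp only: simp_thms)
  qed
  then show "top_index q (Suc k) = top_index q (k - q) + 2"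
    "top_excess q c (Suc k) = top_excess q c (k - q) + int ((q + 1) * c) - 2"
    by (simp_all add: top_index_def top_excess_def algebra_simps)
qed

lemma int_mult_ge: "int q * int c \<ge> 1" "int c \<ge> 1"
proof -
  show "int c \<ge> 1" using c by simp
  have "int 1 \<le> int (q * c)" using q c by (simp only: of_nat_le_iff) simp
  then show "int q * int c \<ge> 1" by simp
qed

text \<open>The critical case is a carry: the remainder passes from \<open>q\<close> to 0, the index
  from 2a + 1 to 2a + 2, and the excess exchanges \<open>q * c - 1\<close> for
  \<open>(q + 1) * c - 2\<close>, which is no loss as \<open>c \<ge> 1\<close>.\<close>

lemma top_mono:
  "top_index q k \<le> top_index q (Suc k)" "top_excess q c k \<le> top_excess q c (Suc k)"
proof -
  define N where "N = k + q - 1"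
  have eq: "k + q - 1 = N" "Suc k + q - 1 = Suc N" using q by (simp_all add: N_def)
  have "top_index q k \<le> top_index q (Suc k) \<and> top_excess q c k \<le> top_excess q c (Suc k)"
  proof (cases "N mod (q + 1) = q")
    case True
    then have "Suc N mod (q + 1) = 0" "Suc N div (q + 1) = Suc (N div (q + 1))"
      by (simp_all add: mod_Suc div_Suc)
    moreover have "0 \<noteq> q" using q by simp
    ultimately have "top_index q k = 2 * (N div (q + 1)) + 1" "top_index q (Suc k) = 2 * Suc (N div (q + 1))"
      "top_excess q c k = int (N div (q + 1)) * (int ((q + 1) * c) - 2) + (int (q * c) - 1)"
      "top_excess q c (Suc k) = int (Suc (N div (q + 1))) * (int ((q + 1) * c) - 2)"
      unfolding top_index_def top_excess_def eq using True by simp_all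
    moreover have "int (Suc a) * M = int a * M + M" for a M by (simp add: distrib_right)
    moreover have "int (q * c) - 1 \<le> int ((q + 1) * c) - 2"
      using c by (simp add: distrib_right)
    ultimately show ?thesis by simp
  next
    case False
    then have "Suc N div (q + 1) = N div (q + 1)"
      by (simp add: mod_Suc div_Suc)
    then show ?thesis
      using False int_mult_ge unfolding top_index_def top_excess_def eq by simp
  qed
  then show "top_index q k \<le> top_index q (Suc k)" "top_excess q c k \<le> top_excess q c (Suc k)"
    by simp_all
qed

text \<open>Old positions are covered by \<open>top_mono\<close>. A new position with both shifts
  gains exactly what \<open>top_step\<close> allows, and one with the generator shift alone gains no
  more than that.\<close>

lemma path_shifts_le:
  "(i, j) \<in> path_shifts q c k \<Longrightarrow> i \<le> top_index q k \<and> j - int i \<le> top_excess q c k"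
proof (induction k arbitrary: i j rule: less_induct)
  case (less k)
  show ?case
  proof (cases k)
    case 0
    then show ?thesis using less.prems by simp (simp add: top_0)
  next
    case (Suc h)
    consider "(i, j) \<in> path_shifts q c h"
      | "h = 0" "i = 1" "j = int (q * c)"
      | a b where "h \<ge> 1" "(a, b) \<in> path_shifts q c (h - q)" "i = Suc a" "j = b + int (q * c)"
      | a b where "h \<ge> 1" "(a, b) \<in> path_shifts q c (h - q)" "i = Suc (Suc a)" "j = b + int c + int (q * c)"
      using less.prems by (auto simp: Suc cone_shift_def split: if_splits)
    then show ?thesis
    proof cases
      case 1
      then show ?thesis using less.IH[of h i j] top_mono[of h] Suc by auto
    next
      case 2
      then show ?thesis using Suc top_1 by simp
    next
      case 3
      then have "a \<le> top_index q (h - q) \<and> b - int a \<le> top_excess q c (h - q)"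
        using Suc by (intro less.IH) auto
      then show ?thesis
        using 3 top_step[of h] int_mult_ge Suc by (simp add: algebra_simps)
    next
      case 4
      then have "a \<le> top_index q (h - q) \<and> b - int a \<le> top_excess q c (h - q)"
        using Suc by (intro less.IH) auto
      then show ?thesis
        using 4 top_step[of h] Suc by (simp add: algebra_simps)
    qed
  qed
qed

text \<open>Always following the double shift makes index and excess grow precisely as in
  \<open>top_step\<close>, so one position attains both bounds.\<close>

lemma top_in_path_shifts:
  "(top_index q k, top_excess q c k + int (top_index q k)) \<in> path_shifts q c k"
proof (induction k rule: less_induct)
  case (less k)
  show ?case
  proof (cases k)
    case 0
    then show ?thesis by simp (simp add: top_0)
  next
    case (Suc h)
    show ?thesis
    proof (cases "h = 0")
      case True
      then show ?thesis using Suc by (simp add: cone_shift_def) (simp add: top_1)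
    next
      case False
      then have h: "h \<ge> 1" by simp
      have "(top_index q (h - q), top_excess q c (h - q) + int (top_index q (h - q)))
          \<in> path_shifts q c (h - q)"
        using Suc by (intro less.IH) simp
      then have "(Suc (Suc (top_index q (h - q))),
          top_excess q c (h - q) + int (top_index q (h - q)) + int c + int (q * c))
          \<in> cone_shift (int (q * c)) (cone_shift (int c) (path_shifts q c (h - q)))"
        by (intro cone_shiftI)
      moreover have "(Suc (Suc (top_index q (h - q))),
          top_excess q c (h - q) + int (top_index q (h - q)) + int c + int (q * c)) =
          (top_index q k, top_excess q c k + int (top_index q k))"
        using top_step[OF h] Suc by (simp add: algebra_simps)
      ultimately have "(top_index q k, top_excess q c k + int (top_index q k))
          \<in> cone_shift (int (q * c)) (cone_shift (int c) (path_shifts q c (h - q)))"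
        by simp
      then show ?thesis
        using False unfolding Suc by (simp add: cone_shift_Un del: of_nat_mult)
    qed
  qed
qed

lemma top_index_ge_1: "k \<ge> 1 \<Longrightarrow> top_index q k \<ge> 1"
proof (induction k rule: dec_induct)
  case (step k)
  then show ?case using top_mono(1)[of k] by simp
qed (simp add: top_1)

lemma finite_path_shifts: "finite (path_shifts q c k)"
proof (induction k rule: less_induct)
  case (less k)
  show ?case
  proof (cases k)
    case (Suc h)
    then have "finite (path_shifts q c h)" "finite (path_shifts q c (h - q))"
      by (auto intro!: less.IH)
    then show ?thesis unfolding Suc by (simp add: cone_shift_def)
  qed simp
qed

end

text \<open>Discarding R lowers each index by one and hence raises each excess by one. The extremal
  position survives because its index is positive.\<close>

lemma proj_dim_regularity_path_shifts:
  assumes b: "\<And>i j. betti n I i j \<noteq> 0 \<longleftrightarrow> (Suc i, j) \<in> path_shifts q c k"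
    and q: "q \<ge> 1" "c \<ge> 1" "k \<ge> 1"
  shows "int (proj_dim n I) = int (top_index q k) - 1" "regularity n I = top_excess q c k + 1"
proof -
  obtain t where t: "top_index q k = Suc t"
    using top_index_ge_1[OF q] by (cases "top_index q k") auto
  have top: "(Suc t, top_excess q c k + int (Suc t)) \<in> path_shifts q c k"
    using top_in_path_shifts[OF q(1,2), of k] by (simp add: t)
  have "{i. \<exists>j. betti n I i j \<noteq> 0} = {i. \<exists>j. (Suc i, j) \<in> path_shifts q c k}"
    by (simp only: b)
  moreover have "Max {i. \<exists>j. (Suc i, j) \<in> path_shifts q c k} = t"
  proof (rule Max_eqI)
    have *: "i \<le> t" if "(Suc i, j) \<in> path_shifts q c k" for i j
      using path_shifts_le[OF q(1,2) that] t by simp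
    then show "i \<le> t" if "i \<in> {i. \<exists>j. (Suc i, j) \<in> path_shifts q c k}" for i
      using that by blast
    show "finite {i. \<exists>j. (Suc i, j) \<in> path_shifts q c k}"
      by (rule finite_subset[of _ "{..t}"]) (use * in auto)
    show "t \<in> {i. \<exists>j. (Suc i, j) \<in> path_shifts q c k}"
      using top by blast
  qed
  ultimately show "int (proj_dim n I) = int (top_index q k) - 1"
    by (simp add: proj_dim_def t)
  have "{j - int i | i j. betti n I i j \<noteq> 0} = {j - int i | i j. (Suc i, j) \<in> path_shifts q c k}"
    by (simp only: b)
  moreover have "Max {j - int i | i j. (Suc i, j) \<in> path_shifts q c k} = top_excess q c k + 1"
  proof (rule Max_eqI)
    have "{j - int i | i j. (Suc i, j) \<in> path_shifts q c k} \<subseteq>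
        (\<lambda>(i, j). j - int i + 1) ` path_shifts q c k"
      by force
    then show "finite {j - int i | i j. (Suc i, j) \<in> path_shifts q c k}"
      by (rule finite_subset) (intro finite_imageI finite_path_shifts q)
    show "x \<le> top_excess q c k + 1" if "x \<in> {j - int i | i j. (Suc i, j) \<in> path_shifts q c k}" for x
      using that path_shifts_le[OF q(1,2), of "Suc _" _ k] by force
    show "top_excess q c k + 1 \<in> {j - int i | i j. (Suc i, j) \<in> path_shifts q c k}"
      using top by force
  qed
  ultimately show "regularity n I = top_excess q c k + 1"
    by (simp add: regularity_def)
qed

theorem theorem3p7:
  fixes k l m n :: nat and p d :: int
    and I :: "'a::field mpoly set"
  assumes "n = k * (m - l) + l"
    and "k \<ge> 1" and "m \<ge> 2"
    and "\<lceil>real m / 2\<rceil> \<le> int l" and "l < m"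
    and "I = path_ideal m l k"
    and "m mod (m - l) = 0"
    and "int n = p * (2 * int m - int l) + d"
    and "0 \<le> d" and "d < 2 * int m - int l"
  shows "(d \<noteq> int m \<longrightarrow> int (proj_dim n I) = 2 * p - 1) \<and>
         (d = int m \<longrightarrow> int (proj_dim n I) = 2 * p) \<and>
         (d \<noteq> int m \<longrightarrow> regularity n I = p * (2 * int m - int l - 2) + 1) \<and>
         (d = int m \<longrightarrow> regularity n I = p * (2 * int m - int l - 2) + int m)"
proof -
  define c where "c = m - l"
  define q where "q = m div c"
  have c: "c \<ge> 1" using assms(5) by (simp add: c_def)
  have m: "m = q * c" using assms(7) by (auto simp: q_def c_def)
  have q: "q \<ge> 1" using m assms(3) by (cases q) auto
  have l: "int l = int m - int c" using assms(5) by (simp add: c_def)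
  have "n + c = k * c + m" using assms(1,5) by (simp add: c_def)
  then have n: "n + c = (k + q) * c" by (simp only: m add_mult_distrib)
  have "n = (k + q) * c - c" using n by linarith
  then have n': "n = (k + q - 1) * c" by (simp only: diff_mult_distrib nat_mult_1)
  have win: "{(i - 1) * (m - l)<..(i - 1) * (m - l) + m} = window q c (i - 1)" for i
    by (simp add: window_def add_mult_distrib flip: m c_def)
  have "path_gen m l ` {1..k} = (\<lambda>i. sqfree_poly (window q c (i - 1)) :: 'a mpoly) ` {1..k}"
    by (rule image_cong) (simp_all only: path_gen_eq win)
  also have "\<dots> = sqfree_poly ` window q c ` (\<lambda>i. i - 1) ` {1..k}"
    by (simp only: image_image)
  also have "(\<lambda>i. i - 1) ` {1..k} = {..<k}"
  proof
    show "{..<k} \<subseteq> (\<lambda>i. i - 1) ` {1..k}"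
      by (rule subsetI, rule_tac x = "Suc x" in image_eqI) auto
  qed auto
  finally have "path_gen m l ` {1..k} = (sqfree_poly ` window q c ` {..<k} :: 'a mpoly set)" .
  moreover have sub: "S \<subseteq> {1..n}" if S: "S \<in> window q c ` {..<k}" for S
  proof -
    obtain i where i: "S = window q c i" "i < k" using S by blast
    have "(i + q) * c \<le> (k + q - 1) * c" using i(2) by (intro mult_le_mono1) simp
    then show ?thesis unfolding i(1) using n' by (intro window_subset) simp
  qed
  ultimately have I: "I = sqfree_ideal n (window q c ` {..<k})"
    using assms(1,6) Idl_sqfree_polys[of "window q c ` {..<k}" n] by (simp add: path_ideal_def)
  have "has_shifts n I (path_shifts q c k)"
    unfolding I using q c n by (intro has_shifts_windows) simp_all
  moreover have "I \<subseteq> poly_carrier n"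
    by (auto simp: I sqfree_ideal_def)
  moreover have "Poly_Mapping.lookup f 0 = 0" if "f \<in> I" for f
  proof -
    have "window q c i \<noteq> {}" for i using q c by (simp add: window_def)
    then have "0 \<notin> Poly_Mapping.keys f"
      using that by (auto simp: I sqfree_ideal_def)
    then show ?thesis by (simp add: in_keys_iff)
  qed
  ultimately have "betti n I i j \<noteq> 0 \<longleftrightarrow> (Suc i, j) \<in> path_shifts q c k" for i j
    by (rule betti_neq_0_iff)
  note pd = proj_dim_regularity_path_shifts[OF this q c assms(2)]
  \<comment> \<open>In units of blocks, \<open>n\<close> is \<open>k + q - 1\<close> and 2m - l is
    \<open>q + 1\<close>. Multiplying this division by \<open>c\<close> gives a division of
    \<open>n\<close> with remainder \<open>b * c\<close>, so uniqueness identifies \<open>p\<close>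
    with \<open>a\<close> and \<open>d\<close> with \<open>b * c\<close>; the case
    \<open>d = m\<close> is then \<open>b = q\<close>.\<close>
  define a where "a = (k + q - 1) div (q + 1)"
  define b where "b = (k + q - 1) mod (q + 1)"
  have b: "b < q + 1" by (simp add: b_def)
  have ab: "k + q - 1 = a * (q + 1) + b" by (simp only: a_def b_def div_mult_mod_eq)
  have den: "2 * int m - int l = int ((q + 1) * c)"
    unfolding l m by (simp add: algebra_simps)
  have ab': "int n = int ((q + 1) * c) * int a + int (b * c)"
    unfolding n' ab by (simp add: algebra_simps)
  have bc: "int (b * c) < int ((q + 1) * c)"
    unfolding of_nat_less_iff using b c by (intro mult_less_mono1) simp_all
  have pd': "int n = int ((q + 1) * c) * p + d" and d_less: "d < int ((q + 1) * c)"
    using assms(8,10) unfolding den by (simp_all only: mult.commute)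
  have p: "p = int a"
    using int_div_pos_eq[OF pd' assms(9) d_less] int_div_pos_eq[OF ab' of_nat_0_le_iff bc] by (rule trans[OF sym])
  have d: "d = int (b * c)"
    using int_mod_pos_eq[OF pd' assms(9) d_less] int_mod_pos_eq[OF ab' of_nat_0_le_iff bc] by (rule trans[OF sym])
  have "d = int m \<longleftrightarrow> b = q"
    unfolding d m of_nat_eq_iff using c by simp
  moreover have "p * (2 * int m - int l - 2) = int a * (int ((q + 1) * c) - 2)"
    by (simp only: den p)
  moreover have "top_index q k = 2 * a + (if b = q then 1 else 0)"
    by (simp only: top_index_def a_def b_def)
  moreover have "top_excess q c k = int a * (int ((q + 1) * c) - 2) + (if b = q then int m - 1 else 0)"
    by (simp only: top_excess_def a_def b_def m)
  ultimately show ?thesis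
    using pd by (cases "b = q") (simp_all, simp_all only: p)
qed

end
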